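(* Let $k\ge 3$, $0\le\alpha<1$, and let $m\ge 6$ be an integer. If $G\in NC(m)$, then $$\rho_\alpha(G)\le \max\{\rho_\alpha(H_1(m,4)),\rho_\alpha(H_2(m,4))\}.$$ Equality holds if and only if $G\cong H_1(m,4)$ or $G\cong H_2(m,4)$.
   Context: A $k$-uniform hypergraph $G=(V(G),E(G))$ has a finite vertex set and an edge set that is a collection of $k$-subsets of $V(G)$ (no repeated edges). The degree of a vertex is the number of edges containing it. An edge is a pendant edge if all its vertices, except at most one, have degree one. A supertree is a hypergraph that is connected and acyclic (no cycle $v_1e_1v_2e_2\dots v_\ell e_\ell v_1$ with $\ell\ge2$, distinct vertices $v_i$ and distinct edges $e_i$, $v_i,v_{i+1}\in e_i$, indices mod $\ell$). A loose path of length $d$ is a hypergraph consisting of distinct edges $e_1,\dots,e_d$ with $|e_i\cap e_j|=1$ if $|i-j|=1$ and $e_i\cap e_j=\varnothing$ if $|i-j|\ge2$. A supertree is a caterpillar if removing all its pendant edges (and the vertices that thereby become isolated) leaves a loose path (possibly trivial, i.e. with no edges; in particular supertrees all of whose edges are pendant count as caterpillars); otherwise it is a non-caterpillar. $NC(m)$ is the set of $k$-uniform non-caterpillar supertrees with $m$ edges; it can be nonempty only if $m\ge6$. The $k$-th power of a simple graph is the $k$-uniform hypergraph obtained by adding $k-2$ new vertices (of degree one) to each edge. The double star $S(s,t)$ is the tree obtained from a single edge by attaching $s$ pendant edges to one end and $t$ pendant edges to the other end. For positive integers $a,b$, $T(s,t;a,b)$ is the tree obtained from $S(s,t)$ by attaching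 two paths, of lengths $a$ and $b$, at the central vertex that carries the $t$ pendant edges (the central vertex of degree $t+1$ in $S(s,t)$); $T^k(s,t;a,b)$ is its $k$-th power. Set $$H_1(m,4)=T^k(1,m-6;2,2),\qquad H_2(m,4)=T^k(m-5,0;2,2).$$ Spectral notation: with $V(G)=\{1,\dots,n\}$, $\mathcal A_\alpha(G)=\alpha\mathcal D(G)+(1-\alpha)\mathcal A(G)$, where $\mathcal D(G)$ is the diagonal tensor of order $k$ and dimension $n$ of vertex degrees and $\mathcal A(G)$ is the adjacency tensor with entries $a_{i_1\dots i_k}=\frac1{(k-1)!}$ if $\{i_1,\dots,i_k\}\in E(G)$ and $0$ otherwise; equivalently $(\mathcal A_\alpha(G)\boldsymbol x)_v=\alpha d_vx_v^{k-1}+(1-\alpha)\sum_{e\ni v}\prod_{w\in e\setminus\{v\}}x_w$, $d_v$ the degree of $v$. An eigenvalue is $\lambda\in\mathbb C$ with $\mathcal A_\alpha(G)\boldsymbol x=\lambda (x_i^{k-1})_i$ for some nonzero $\boldsymbol x\in\mathbb C^n$. The $\alpha$-spectral radius $\rho_\alpha(G)$ is the largest modulus of an eigenvalue of $\mathcal A_\alpha(G)$.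
   Formalization: Equality is characterized as: G is isomorphic to one of H_1(m,4), H_2(m,4) that attains the maximum; as printed the "if" part fails when the two radii differ (e.g. k=3, α=0, m=7, G=H_2). *)

theory Defs
  imports "HOL-Analysis.Analysis"
begin

datatype 'a hypergraph = Hypergraph (verts: "'a set") (edges: "'a set set")

definition uniform_hypergraph :: "nat \<Rightarrow> 'a hypergraph \<Rightarrow> bool" where
  "uniform_hypergraph k G \<longleftrightarrow>
     finite (verts G) \<and> (\<forall>e\<in>edges G. e \<subseteq> verts G \<and> card e = k)"

definition vertex_degree :: "'a hypergraph \<Rightarrow> 'a \<Rightarrow> nat" where
  "vertex_degree G v = card {e \<in> edges G. v \<in> e}"

definition connected_hypergraph :: "'a hypergraph \<Rightarrow> bool" where
  "connected_hypergraph G \<longleftrightarrow>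
     (\<forall>u\<in>verts G. \<forall>v\<in>verts G. (u, v) \<in> {(x, y). \<exists>e\<in>edges G. x \<in> e \<and> y \<in> e}\<^sup>*)"

definition hypergraph_cycle :: "'a hypergraph \<Rightarrow> 'a list \<Rightarrow> 'a set list \<Rightarrow> bool" where
  "hypergraph_cycle G vs es \<longleftrightarrow>
     length vs = length es \<and> 2 \<le> length es \<and> distinct vs \<and> distinct es \<and>
     set vs \<subseteq> verts G \<and> set es \<subseteq> edges G \<and>
     (\<forall>i<length es. vs ! i \<in> es ! i \<and> vs ! (Suc i mod length vs) \<in> es ! i)"

definition acyclic_hypergraph :: "'a hypergraph \<Rightarrow> bool" where
  "acyclic_hypergraph G \<longleftrightarrow> (\<nexists>vs es. hypergraph_cycle G vs es)"

definition supertree :: "'a hypergraph \<Rightarrow> bool" where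
  "supertree G \<longleftrightarrow> connected_hypergraph G \<and> acyclic_hypergraph G"

definition pendant_edge :: "'a hypergraph \<Rightarrow> 'a set \<Rightarrow> bool" where
  "pendant_edge G e \<longleftrightarrow> e \<in> edges G \<and> card {v \<in> e. vertex_degree G v \<noteq> 1} \<le> 1"

definition remove_pendant :: "'a hypergraph \<Rightarrow> 'a hypergraph" where
  "remove_pendant G =
     (let E = {e \<in> edges G. \<not> pendant_edge G e}
      in Hypergraph (verts G - (\<Union>(edges G) - \<Union>E)) E)"

text \<open>The trivial loose path has no edges; it may or may not retain a single vertex
  (removing all edges of a star leaves no vertex under \<^const>\<open>remove_pendant\<close>).\<close>

definition loose_path :: "'a hypergraph \<Rightarrow> bool" where
  "loose_path P \<longleftrightarrow>
     (\<exists>es. distinct es \<and> set es = edges P \<and>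
       (\<forall>i j. i < j \<and> j < length es \<longrightarrow>
          (if j = Suc i then card (es ! i \<inter> es ! j) = 1 else es ! i \<inter> es ! j = {}))) \<and>
     (verts P = \<Union>(edges P) \<or> edges P = {} \<and> card (verts P) = 1)"

definition caterpillar :: "'a hypergraph \<Rightarrow> bool" where
  "caterpillar G \<longleftrightarrow> supertree G \<and> loose_path (remove_pendant G)"

definition NC :: "nat \<Rightarrow> nat \<Rightarrow> 'a hypergraph set" where
  "NC k m = {G. uniform_hypergraph k G \<and> supertree G \<and> \<not> caterpillar G \<and> card (edges G) = m}"

definition hypergraph_iso :: "'a hypergraph \<Rightarrow> 'b hypergraph \<Rightarrow> bool" (infix "\<cong>\<^sub>h" 50) where
  "G \<cong>\<^sub>h H \<longleftrightarrow> (\<exists>f. bij_betw f (verts G) (verts H) \<and> edges H = (`) f ` edges G)"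

text \<open>Simple graphs are 2-uniform hypergraphs. The vertices \<open>Inr (e, i)\<close> with \<open>i < k - 2\<close>
  are the new vertices of the edge \<open>e\<close>.\<close>

definition power_graph :: "nat \<Rightarrow> 'a hypergraph \<Rightarrow> ('a + 'a set \<times> nat) hypergraph" where
  "power_graph k T = Hypergraph
     (Inl ` verts T \<union> {Inr (e, i) | e i. e \<in> edges T \<and> i < k - 2})
     {Inl ` e \<union> {Inr (e, i) | i. i < k - 2} | e. e \<in> edges T}"

text \<open>\<open>LeafU\<close> and \<open>LeafV\<close> are the leaves attached at the two ends \<open>CenterU\<close> and \<open>CenterV\<close> of the
  central edge; \<open>PathA i\<close> and \<open>PathB i\<close> are the vertices at distance \<open>i + 1\<close> from \<open>CenterV\<close> on
  the two attached paths.\<close>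

datatype tvertex =
  CenterU | CenterV | LeafU nat | LeafV nat | PathA nat | PathB nat

definition double_star :: "nat \<Rightarrow> nat \<Rightarrow> tvertex hypergraph" where
  "double_star s t = Hypergraph
     ({CenterU, CenterV} \<union> LeafU ` {..<s} \<union> LeafV ` {..<t})
     ({{CenterU, CenterV}} \<union> {{CenterU, LeafU i} | i. i < s} \<union> {{CenterV, LeafV i} | i. i < t})"

fun pathA :: "nat \<Rightarrow> tvertex" where
  "pathA 0 = CenterV"
| "pathA (Suc i) = PathA i"

fun pathB :: "nat \<Rightarrow> tvertex" where
  "pathB 0 = CenterV"
| "pathB (Suc i) = PathB i"

definition T_graph :: "nat \<Rightarrow> nat \<Rightarrow> nat \<Rightarrow> nat \<Rightarrow> tvertex hypergraph" where
  "T_graph s t a b = Hypergraph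
     (verts (double_star s t) \<union> pathA ` {..a} \<union> pathB ` {..b})
     (edges (double_star s t) \<union> {{pathA i, pathA (Suc i)} | i. i < a}
        \<union> {{pathB i, pathB (Suc i)} | i. i < b})"

definition H1 :: "nat \<Rightarrow> nat \<Rightarrow> (tvertex + tvertex set \<times> nat) hypergraph" where
  "H1 k m = power_graph k (T_graph 1 (m - 6) 2 2)"

definition H2 :: "nat \<Rightarrow> nat \<Rightarrow> (tvertex + tvertex set \<times> nat) hypergraph" where
  "H2 k m = power_graph k (T_graph (m - 5) 0 2 2)"

text \<open>A tensor of order \<open>k\<close> with index set \<open>V\<close> is a function on index lists; only the lists of
  length \<open>k\<close> with entries in \<open>V\<close> matter.\<close>

type_synonym 'a tensor = "'a list \<Rightarrow> real"

definition degree_tensor :: "'a hypergraph \<Rightarrow> 'a tensor" where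
  "degree_tensor G ws =
     (if ws \<noteq> [] \<and> set ws = {hd ws} then real (vertex_degree G (hd ws)) else 0)"

text \<open>If \<open>ws\<close> has length \<open>k\<close> and \<open>G\<close> is \<open>k\<close>-uniform, \<open>set ws \<in> edges G\<close> forces the entries
  of \<open>ws\<close> to be distinct.\<close>

definition adjacency_tensor :: "nat \<Rightarrow> 'a hypergraph \<Rightarrow> 'a tensor" where
  "adjacency_tensor k G ws = (if set ws \<in> edges G then 1 / fact (k - 1) else 0)"

definition A_tensor :: "nat \<Rightarrow> real \<Rightarrow> 'a hypergraph \<Rightarrow> 'a tensor" where
  "A_tensor k \<alpha> G ws = \<alpha> * degree_tensor G ws + (1 - \<alpha>) * adjacency_tensor k G ws"

definition tensor_apply :: "'a set \<Rightarrow> nat \<Rightarrow> 'a tensor \<Rightarrow> ('a \<Rightarrow> complex) \<Rightarrow> 'a \<Rightarrow> complex" where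
  "tensor_apply V k A x v =
     (\<Sum>ws | set ws \<subseteq> V \<and> length ws = k - 1. of_real (A (v # ws)) * (\<Prod>w\<leftarrow>ws. x w))"

definition tensor_eigenvalue :: "'a set \<Rightarrow> nat \<Rightarrow> 'a tensor \<Rightarrow> complex \<Rightarrow> bool" where
  "tensor_eigenvalue V k A \<mu> \<longleftrightarrow>
     (\<exists>x. (\<exists>v\<in>V. x v \<noteq> 0) \<and> (\<forall>v\<in>V. tensor_apply V k A x v = \<mu> * x v ^ (k - 1)))"

text \<open>The set of eigenvalues of a tensor is compact, and nonempty for the tensors considered
  here, so this supremum is the largest modulus of an eigenvalue.\<close>

definition rho :: "nat \<Rightarrow> real \<Rightarrow> 'a hypergraph \<Rightarrow> real" where
  "rho k \<alpha> G = Sup (cmod ` {\<mu>. tensor_eigenvalue (verts G) k (A_tensor k \<alpha> G) \<mu>})"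

end

theory Submission
  imports Defs "HOL-Combinatorics.Multiset_Permutations"
begin

text \<open>Let \<open>G\<close> maximise the \<open>\<alpha>\<close>-spectral radius among the non-caterpillar supertrees with the given
  vertex set and number of edges. The radius is the maximum of the form \<open>\<A>\<^sub>\<alpha> x\<^sup>k\<close> over nonnegative
  \<open>x\<close> with \<open>\<Sum>x\<^sub>v\<^sup>k = 1\<close>, attained at a positive eigenvector, so moving edges from a vertex \<open>w\<close> to a
  vertex \<open>u\<close> with \<open>x\<^sub>w \<le> x\<^sub>u\<close> strictly increases it. A non-caterpillar has three non-pendant edges at
  a common vertex, or an edge with three non-pendant neighbours at distinct vertices. Contracting
  an edge at two of its non-leaf vertices (all other edges at one are moved to the other) shows that
  in \<open>G\<close> there are exactly three non-pendant edges, all at one vertex \<open>v\<close>, each with exactly one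
  further branching vertex. Moving one pendant edge between these four vertices shows that at most
  one of them carries more pendant edges than the non-caterpillar property forces: if it is \<open>v\<close> or
  none, \<open>G\<close> is \<open>H\<^sub>1(m,4)\<close>, otherwise it is \<open>H\<^sub>2(m,4)\<close>.\<close>

section \<open>Supertrees by counting vertices\<close>

text \<open>Which of two Perron entries is larger is never known, so a modification is useful only
  if both directions, from \<open>w\<close> to \<open>u\<close> and from \<open>u\<close> to
  \<open>w\<close>, lead to admissible competitors. This shapes the class and the moves. Competitors
  are connected uniform edge sets on one fixed finite vertex set with the vertex count of a
  supertree; their branching is expressed through vertices of degree at least two, which a move can
  destroy only at its source. A contraction keeps three branching edges together in either
  direction, and a pendant edge may leave a vertex when enough edges remain there.

  The constants: three edges at \<open>v\<close> and one pendant edge at each of the three outer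
  branching vertices are forced, which leaves m - 6 free pendant edges. If they all sit at one outer
  vertex, it carries m - 5 pendant edges in total. The radii of the two candidates are not compared
  with each other; hence the maximum in the bound, and hence equality asks for an isomorphism with a
  candidate that attains it.\<close>

text \<open>Connectivity by closed vertex sets, a form that is easily transported along moves of edges.\<close>

definition hconn :: "'a set \<Rightarrow> 'a set set \<Rightarrow> bool" where
  "hconn V E \<longleftrightarrow> (\<forall>S\<subseteq>V. S \<noteq> {} \<and> (\<forall>e\<in>E. e \<inter> S \<noteq> {} \<longrightarrow> e \<subseteq> S) \<longrightarrow> S = V)"

text \<open>Degree at least two, stated by two witnesses instead of a cardinality, so that it passes
  through any injective map of edges that keeps \<open>z\<close> in both witnesses.\<close>

definition deg2 :: "'a set set \<Rightarrow> 'a \<Rightarrow> bool" where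
  "deg2 E z \<longleftrightarrow> (\<exists>f\<in>E. \<exists>g\<in>E. f \<noteq> g \<and> z \<in> f \<and> z \<in> g)"

definition nonpendant :: "'a set set \<Rightarrow> 'a set \<Rightarrow> bool" where
  "nonpendant E e \<longleftrightarrow> (\<exists>a\<in>e. \<exists>b\<in>e. a \<noteq> b \<and> deg2 E a \<and> deg2 E b)"

definition branch_vertex :: "'a set set \<Rightarrow> bool" where
  "branch_vertex E \<longleftrightarrow> (\<exists>v e1 e2 e3. {e1, e2, e3} \<subseteq> E \<and> distinct [e1, e2, e3] \<and>
     v \<in> e1 \<and> v \<in> e2 \<and> v \<in> e3 \<and> nonpendant E e1 \<and> nonpendant E e2 \<and> nonpendant E e3)"

text \<open>In a hypertree \<open>f1\<close>, \<open>f2\<close>, \<open>f3\<close> are automatically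
  distinct: two equal ones would share two vertices with \<open>e\<close>.\<close>

definition branch_edge :: "'a set set \<Rightarrow> bool" where
  "branch_edge E \<longleftrightarrow> (\<exists>e v1 v2 v3 f1 f2 f3. {e, f1, f2, f3} \<subseteq> E \<and> e \<notin> {f1, f2, f3} \<and>
     distinct [v1, v2, v3] \<and> {v1, v2, v3} \<subseteq> e \<and> v1 \<in> f1 \<and> v2 \<in> f2 \<and> v3 \<in> f3 \<and>
     nonpendant E f1 \<and> nonpendant E f2 \<and> nonpendant E f3)"

lemma branch_vertexI:
  assumes "e1 \<in> E" "e2 \<in> E" "e3 \<in> E" "e1 \<noteq> e2" "e1 \<noteq> e3" "e2 \<noteq> e3"
    and "v \<in> e1" "v \<in> e2" "v \<in> e3" "nonpendant E e1" "nonpendant E e2" "nonpendant E e3"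
  shows "branch_vertex E"
  unfolding branch_vertex_def using assms
  by (intro exI[of _ v] exI[of _ e1] exI[of _ e2] exI[of _ e3]) simp

lemma deg2I: "f \<in> E \<Longrightarrow> g \<in> E \<Longrightarrow> f \<noteq> g \<Longrightarrow> z \<in> f \<Longrightarrow> z \<in> g \<Longrightarrow> deg2 E z"
  unfolding deg2_def by blast

lemma nonpendantI: "a \<in> e \<Longrightarrow> b \<in> e \<Longrightarrow> a \<noteq> b \<Longrightarrow> deg2 E a \<Longrightarrow> deg2 E b \<Longrightarrow> nonpendant E e"
  unfolding nonpendant_def by blast

lemma hconnD:
  assumes "hconn V E" "S \<subseteq> V" "S \<noteq> {}" "\<And>e. e \<in> E \<Longrightarrow> e \<inter> S \<noteq> {} \<Longrightarrow> e \<subseteq> S"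
  shows "S = V"
  using assms unfolding hconn_def by blast

locale uniform_edges =
  fixes k :: nat and V :: "'a set" and E :: "'a set set"
  assumes finite_verts: "finite V"
    and edge_subset: "e \<in> E \<Longrightarrow> e \<subseteq> V"
    and card_edge: "e \<in> E \<Longrightarrow> card e = k"
    and k_ge_3: "3 \<le> k"
begin

lemma finite_edges: "finite E"
  using finite_verts edge_subset by (meson Pow_iff finite_Pow_iff finite_subset subsetI)

lemma finite_edge: "e \<in> E \<Longrightarrow> finite e"
  using finite_verts edge_subset finite_subset by blast

lemma edge_nonempty: "e \<in> E \<Longrightarrow> e \<noteq> {}"
  using card_edge k_ge_3 by fastforce

lemma card_Union_insert_le:
  assumes "F \<subseteq> E" "g \<in> E" "g \<inter> \<Union>F \<noteq> {}"
  shows "card (\<Union>(insert g F)) \<le> card (\<Union>F) + (k - 1)"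
proof -
  have fin: "finite (\<Union>F)"
    using assms(1) finite_verts edge_subset by (meson Union_least finite_subset subsetD)
  have "card (g \<inter> \<Union>F) \<ge> 1"
    using assms fin finite_edge by (simp add: card_gt_0_iff Suc_leI)
  moreover have "card (g \<union> \<Union>F) + card (g \<inter> \<Union>F) = k + card (\<Union>F)"
    using card_Un_Int[of g "\<Union>F"] fin finite_edge assms card_edge by simp
  ultimately show ?thesis by simp
qed

text \<open>The edges outside \<open>F\<close> can be added one at a time, each meeting the union of the previous ones.\<close>

lemma card_verts_le:
  assumes "hconn V E" "F \<subseteq> E" "F \<noteq> {}"
  shows "card V \<le> card (\<Union>F) + (card E - card F) * (k - 1)"
  using assms(2,3)
proof (induction "card (E - F)" arbitrary: F rule: less_induct)
  case less
  show ?case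
  proof (cases "\<exists>g\<in>E - F. g \<inter> \<Union>F \<noteq> {}")
    case True
    then obtain g where g: "g \<in> E" "g \<notin> F" "g \<inter> \<Union>F \<noteq> {}" by blast
    have finF: "finite F" using less finite_edges finite_subset by blast
    have lt: "card F < card E"
      using g less(2) finite_edges by (metis psubset_card_mono psubsetI)
    have "card (E - insert g F) < card (E - F)"
      using g finite_edges by (intro psubset_card_mono) auto
    then have "card V \<le> card (\<Union>(insert g F)) + (card E - card (insert g F)) * (k - 1)"
      using less(1)[of "insert g F"] less(2) g by auto
    also have "\<dots> \<le> card (\<Union>F) + (k - 1) + (card E - card (insert g F)) * (k - 1)"
      using card_Union_insert_le less(2) g by simp
    also have "\<dots> = card (\<Union>F) + (card E - card F) * (k - 1)"
    proof -
      have "card E - card F = Suc (card E - card (insert g F))" using finF g lt by simp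
      then show ?thesis by simp
    qed
    finally show ?thesis .
  next
    case False
    have "\<Union>F = V"
    proof (rule hconnD[OF assms(1)])
      show "\<Union>F \<subseteq> V" using less(2) edge_subset by blast
      show "\<Union>F \<noteq> {}" using less(2,3) edge_nonempty by fastforce
    qed (use False in blast)
    then show ?thesis by simp
  qed
qed

end

text \<open>For connected hypergraphs the vertex count is equivalent to acyclicity; only the direction from
  acyclicity is needed.\<close>

locale hypertree = uniform_edges +
  assumes conn: "hconn V E"
    and card_verts: "card V = 1 + card E * (k - 1)"
begin

text \<open>If the union were smaller, the remaining edges, each adding at most \<open>k - 1\<close>
  new vertices, could not reach \<open>card V\<close>.\<close>

lemma card_Union_ge:
  assumes "F \<subseteq> E" "F \<noteq> {}"
  shows "1 + card F * (k - 1) \<le> card (\<Union>F)"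
proof -
  have "card F \<le> card E" using assms finite_edges card_mono by blast
  then have "card E * (k - 1) = (card E - card F) * (k - 1) + card F * (k - 1)"
    by (metis add_mult_distrib le_add_diff_inverse2)
  then show ?thesis using card_verts_le[OF conn assms] card_verts by linarith
qed

text \<open>This is acyclicity in counting form. The union of \<open>F\<close> is as small as
  \<open>card_Union_ge\<close> permits, so a further edge must bring \<open>k - 1\<close> new
  vertices. A single edge as \<open>F\<close> gives linearity; a loose path as \<open>F\<close>
  controls how it can be extended.\<close>

lemma card_Int_Union_le_1:
  assumes "F \<subseteq> E" "card (\<Union>F) \<le> 1 + card F * (k - 1)" "g \<in> E" "g \<notin> F"
  shows "card (g \<inter> \<Union>F) \<le> 1"
proof -
  have fin: "finite (\<Union>F)" "finite F"
    using assms(1) finite_verts edge_subset finite_edges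
    by (meson Union_least finite_subset subsetD)+
  have "1 + card (insert g F) * (k - 1) \<le> card (g \<union> \<Union>F)"
    using card_Union_ge[of "insert g F"] assms by simp
  moreover have "card (g \<union> \<Union>F) + card (g \<inter> \<Union>F) = k + card (\<Union>F)"
    using card_Un_Int[of g "\<Union>F"] fin finite_edge assms card_edge by simp
  ultimately show ?thesis using assms fin k_ge_3 by simp
qed

lemma card_Int_le_1:
  assumes "f \<in> E" "g \<in> E" "f \<noteq> g"
  shows "card (f \<inter> g) \<le> 1"
  using card_Int_Union_le_1[of "{g}" f] assms card_edge k_ge_3 by simp

lemma linear:
  assumes "f \<in> E" "g \<in> E" "a \<in> f" "a \<in> g" "b \<in> f" "b \<in> g" "a \<noteq> b"
  shows "f = g"
proof (rule ccontr)
  assume "f \<noteq> g"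
  then have "card (f \<inter> g) \<le> 1" using card_Int_le_1 assms by blast
  moreover have "card {a, b} \<le> card (f \<inter> g)"
    using assms finite_edge by (intro card_mono) auto
  ultimately show False using assms by simp
qed

lemma Union_edges:
  assumes "E \<noteq> {}"
  shows "\<Union>E = V"
  by (rule hconnD[OF conn]) (use edge_subset edge_nonempty assms in blast)+

end

section \<open>Acyclicity forces the vertex count\<close>

definition linked :: "'a set set \<Rightarrow> ('a \<times> 'a) set" where
  "linked F = {(x, y). \<exists>e\<in>F. x \<in> e \<and> y \<in> e}"

lemma linked_iff: "(x, y) \<in> linked F \<longleftrightarrow> (\<exists>e\<in>F. x \<in> e \<and> y \<in> e)"
  by (simp add: linked_def)

lemma hconn_of_connected:
  assumes "connected_hypergraph G"
  shows "hconn (verts G) (edges G)"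
  unfolding hconn_def
proof (intro allI impI)
  fix S assume S: "S \<subseteq> verts G"
    "S \<noteq> {} \<and> (\<forall>e\<in>edges G. e \<inter> S \<noteq> {} \<longrightarrow> e \<subseteq> S)"
  then obtain s where s: "s \<in> S" by blast
  have "t \<in> S" if "(s, t) \<in> (linked (edges G))\<^sup>*" for t
    using that by (induction rule: rtrancl_induct) (use s S in \<open>auto simp: linked_iff\<close>)
  then show "S = verts G"
    using assms S s unfolding connected_hypergraph_def linked_def by blast
qed

text \<open>A shortest chain from \<open>a\<close> to \<open>b\<close> inside \<open>F\<close>
  repeats neither a vertex nor an edge, and \<open>g\<close> closes it to a cycle.\<close>

lemma cycle_of_linked:
  assumes "F \<subseteq> edges G" "g \<in> edges G" "g \<notin> F" "a \<in> g" "b \<in> g" "a \<noteq> b"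
    and "(a, b) \<in> (linked F)\<^sup>*" and sub: "\<And>e. e \<in> edges G \<Longrightarrow> e \<subseteq> verts G"
  shows "\<exists>vs es. hypergraph_cycle G vs es"
proof -
  let ?R = "linked F"
  define n where "n = (LEAST n. (a, b) \<in> ?R ^^ n)"
  have n: "(a, b) \<in> ?R ^^ n"
    unfolding n_def using assms(7) by (metis LeastI rtrancl_power)
  have short: "n \<le> l" if "(a, b) \<in> ?R ^^ l" for l
    using that unfolding n_def by (rule Least_le)
  from n obtain p where p: "p 0 = a" "p n = b" "\<And>i. i < n \<Longrightarrow> (p i, p (Suc i)) \<in> ?R"
    using relpow_fun_conv[of a b n ?R] by auto
  have seg: "(p i, p (i + d)) \<in> ?R ^^ d" if "i + d \<le> n" for i d
    using that
  proof (induction d)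
    case (Suc d)
    then have "(p i, p (i + d)) \<in> ?R ^^ d" "(p (i + d), p (i + Suc d)) \<in> ?R"
      using p(3)[of "i + d"] by auto
    then show ?case by auto
  qed simp
  \<comment> \<open>Minimality of \<open>n\<close>: replacing the segment between \<open>p i\<close>
    and \<open>p j\<close> by \<open>d\<close> steps cannot shorten the chain. With
    \<open>d = 0\<close> this separates the vertices, with \<open>d = 1\<close> the edges.\<close>
  have gap: "j - i \<le> d" if "i \<le> j" "j \<le> n" "(p i, p j) \<in> ?R ^^ d" for i j d
  proof -
    have "(a, p i) \<in> ?R ^^ i" using seg[of 0 i] that p by simp
    moreover have "(p j, b) \<in> ?R ^^ (n - j)" using seg[of j "n - j"] that p by simp
    ultimately have "(a, b) \<in> ?R ^^ (i + (d + (n - j)))"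
      using that(3) unfolding relpow_add by (meson relcompI)
    then have "n \<le> i + (d + (n - j))" by (rule short)
    then show ?thesis using that by linarith
  qed
  have "n > 0" using n assms(6) by (cases n) auto
  have "\<forall>i. \<exists>e. i < n \<longrightarrow> e \<in> F \<and> p i \<in> e \<and> p (Suc i) \<in> e" using p(3) unfolding linked_iff by blast
  then obtain q where q: "\<And>i. i < n \<Longrightarrow> q i \<in> F \<and> p i \<in> q i \<and> p (Suc i) \<in> q i" by metis
  have p_inj: "inj_on p {..n}"
  proof (rule linorder_inj_onI)
    fix i j assume "i < j" "i \<in> {..n}" "j \<in> {..n}"
    then show "p i \<noteq> p j" using gap[of i j 0] by auto
  qed auto
  have q_inj: "inj_on q {..<n}"
  proof (rule linorder_inj_onI)
    fix i j assume ij: "i < j" "i \<in> {..<n}" "j \<in> {..<n}"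
    show "q i \<noteq> q j"
    proof
      assume "q i = q j"
      then have "(p i, p (Suc j)) \<in> ?R"
        using q[of i] q[of j] ij unfolding linked_iff by (metis lessThan_iff)
      then have "(p i, p (Suc j)) \<in> ?R ^^ 1" by simp
      then show False using gap[of i "Suc j" 1] ij by auto
    qed
  qed auto
  define vs where "vs = map p [0..<Suc n]"
  \<comment> \<open>The edge \<open>g\<close> at position \<open>n\<close> leads from
    \<open>p n = b\<close> back to \<open>p 0 = a\<close>; as \<open>a\<close> and \<open>b\<close>
    differ, \<open>n > 0\<close> and the cycle has length at least two.\<close>
  define es where "es = map q [0..<n] @ [g]"
  have len: "length vs = Suc n" "length es = Suc n" by (auto simp: vs_def es_def)
  have es_nth: "es ! i = (if i < n then q i else g)" if "i < Suc n" for i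
    using that by (auto simp: es_def nth_append)
  have vs_nth: "vs ! i = p i" if "i < Suc n" for i
    using that unfolding vs_def by (subst nth_map) (auto simp del: upt_Suc)
  have p_verts: "p i \<in> verts G" if "i \<le> n" for i
  proof (cases "i < n")
    case True then show ?thesis using q[of i] assms(1) sub by blast
  next
    case False then show ?thesis using that p assms sub by force
  qed
  have "hypergraph_cycle G vs es"
    unfolding hypergraph_cycle_def
  proof (intro conjI allI impI)
    show "distinct vs"
      unfolding vs_def distinct_map using p_inj by (auto simp: atLeast0_lessThan_Suc inj_on_def)
    show "distinct es"
      unfolding es_def using q_inj q assms(3) by (auto simp: distinct_map inj_on_def)
    show "set vs \<subseteq> verts G" unfolding vs_def using p_verts by auto
    show "set es \<subseteq> edges G" unfolding es_def using q assms by auto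
    fix i assume i: "i < length es"
    show "vs ! i \<in> es ! i"
      using i len es_nth[of i] vs_nth[of i] q[of i] p assms(5) by (cases "i < n") (auto simp: less_Suc_eq)
    show "vs ! (Suc i mod length vs) \<in> es ! i"
    proof (cases "i < n")
      case True
      then show ?thesis using len es_nth[of i] vs_nth[of "Suc i"] q[of i] by simp
    next
      case False
      then have "i = n" using i len by simp
      then show ?thesis using len es_nth[of n] vs_nth[of 0] p assms(4) by simp
    qed
  qed (use len \<open>n > 0\<close> in auto)
  then show ?thesis by blast
qed

text \<open>An edge that meets the connected part built so far in two vertices would close a cycle.\<close>

lemma hypertree_of_supertree:
  assumes "uniform_hypergraph k G" "supertree G" "3 \<le> k" "edges G \<noteq> {}"
  shows "hypertree k (verts G) (edges G)"
proof -
  interpret uniform_edges k "verts G" "edges G"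
    using assms(1,3) by unfold_locales (auto simp: uniform_hypergraph_def)
  have con: "hconn (verts G) (edges G)"
    using assms(2) hconn_of_connected unfolding supertree_def by blast
  have nocycle: "\<nexists>vs es. hypergraph_cycle G vs es"
    using assms(2) unfolding supertree_def acyclic_hypergraph_def by blast
  \<comment> \<open>The last conjunct keeps \<open>F\<close> connected through its own edges, which
    is what \<open>cycle_of_linked\<close> requires of a new edge meeting \<open>F\<close> in two
    vertices.\<close>
  have "\<exists>F\<subseteq>edges G. card F = Suc n \<and> card (\<Union>F) = 1 + Suc n * (k - 1) \<and>
      (\<forall>a\<in>\<Union>F. \<forall>b\<in>\<Union>F. (a, b) \<in> (linked F)\<^sup>*)" if "Suc n \<le> card (edges G)" for n
    using that
  proof (induction n)
    case 0
    obtain e where e: "e \<in> edges G" using assms(4) by blast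
    have "(a, b) \<in> (linked {e})\<^sup>*" if "a \<in> e" "b \<in> e" for a b
      using that by (intro r_into_rtrancl) (simp add: linked_iff)
    then have "\<forall>a\<in>\<Union>{e}. \<forall>b\<in>\<Union>{e}. (a, b) \<in> (linked {e})\<^sup>*" by simp
    moreover have "card (\<Union>{e}) = 1 + Suc 0 * (k - 1)" using card_edge[OF e] k_ge_3 by simp
    ultimately show ?case using e by (intro exI[of _ "{e}"] conjI) simp_all
  next
    case (Suc n)
    then obtain F where F: "F \<subseteq> edges G" "card F = Suc n" "card (\<Union>F) = 1 + Suc n * (k - 1)"
      "\<forall>a\<in>\<Union>F. \<forall>b\<in>\<Union>F. (a, b) \<in> (linked F)\<^sup>*"
      using Suc.IH[OF Suc_leD[OF Suc.prems]] by (elim exE conjE)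
    have finF: "finite F" using F(1) finite_edges finite_subset by blast
    have finUF: "finite (\<Union>F)" using F(1) finite_verts edge_subset
      by (meson Union_least finite_subset subsetD)
    have ne: "F \<noteq> {}" using F(2) by auto
    have "\<exists>g\<in>edges G - F. g \<inter> \<Union>F \<noteq> {}"
    proof (rule ccontr)
      assume no: "\<not> ?thesis"
      have UF: "\<Union>F = verts G"
      proof (rule hconnD[OF con])
        show "\<Union>F \<subseteq> verts G" using F(1) edge_subset by blast
        show "\<Union>F \<noteq> {}" using ne F(1) edge_nonempty by fastforce
      qed (use no in blast)
      have "F \<noteq> edges G" using Suc.prems F(2) by auto
      then obtain h where h: "h \<in> edges G" "h \<notin> F" using F(1) by blast
      then have "h \<inter> \<Union>F = h" using UF edge_subset[of h] by (simp add: Int_absorb2)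
      then show False using no h edge_nonempty[OF h(1)] by auto
    qed
    then obtain g a where g: "g \<in> edges G" "g \<notin> F" "a \<in> g" "a \<in> \<Union>F" by blast
    have only: "b = a" if "b \<in> g" "b \<in> \<Union>F" for b
    proof (rule ccontr)
      assume "b \<noteq> a"
      moreover have "(b, a) \<in> (linked F)\<^sup>*" using bspec[OF bspec[OF F(4) that(2)] g(4)] .
      ultimately show False
        using cycle_of_linked[OF F(1) g(1,2) that(1) g(3)] edge_subset nocycle by simp
    qed
    then have gi: "g \<inter> \<Union>F = {a}" using g by blast
    have "card (g \<union> \<Union>F) + card (g \<inter> \<Union>F) = k + card (\<Union>F)"
      using card_Un_Int[of g "\<Union>F"] finUF finite_edge g card_edge by simp
    then have c: "card (\<Union>(insert g F)) = 1 + Suc (Suc n) * (k - 1)"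
      using F(3) gi k_ge_3 by simp
    have mono: "(linked F)\<^sup>* \<subseteq> (linked (insert g F))\<^sup>*" by (intro rtrancl_mono) (auto simp: linked_def)
    have toa: "(b, a) \<in> (linked (insert g F))\<^sup>* \<and> (a, b) \<in> (linked (insert g F))\<^sup>*"
      if "b \<in> \<Union>(insert g F)" for b
    proof (cases "b \<in> g")
      case True
      then show ?thesis using g by (auto intro!: r_into_rtrancl simp: linked_iff)
    next
      case False
      then have "b \<in> \<Union>F" using that by blast
      then have "(b, a) \<in> (linked F)\<^sup>*" "(a, b) \<in> (linked F)\<^sup>*"
        using bspec[OF bspec[OF F(4)]] g(4) by blast+
      then show ?thesis using mono by (simp only: subsetD)
    qed
    have "\<forall>b\<in>\<Union>(insert g F). \<forall>c\<in>\<Union>(insert g F). (b, c) \<in> (linked (insert g F))\<^sup>*"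
    proof (intro ballI)
      fix b c assume "b \<in> \<Union>(insert g F)" "c \<in> \<Union>(insert g F)"
      then show "(b, c) \<in> (linked (insert g F))\<^sup>*"
        using toa[of b] toa[of c] by (simp only: rtrancl_trans[of b a _ c])
    qed
    moreover have "insert g F \<subseteq> edges G" "card (insert g F) = Suc (Suc n)"
      using F(1,2) g finF by simp_all
    ultimately show ?case using c by (intro exI[of _ "insert g F"] conjI)
  qed
  moreover have "Suc (card (edges G) - 1) = card (edges G)"
    using assms(4) finite_edges by (simp add: card_gt_0_iff)
  ultimately obtain F where
    F: "F \<subseteq> edges G" "card F = card (edges G)" "card (\<Union>F) = 1 + card (edges G) * (k - 1)"
    by (metis order_refl)
  then have "F = edges G" using finite_edges card_subset_eq by blast
  moreover have "\<Union>(edges G) = verts G"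
    by (rule hconnD[OF con]) (use edge_subset edge_nonempty assms(4) in blast)+
  ultimately show ?thesis using con F by unfold_locales auto
qed

section \<open>Branching in non-caterpillars\<close>

definition loose_list :: "'a set list \<Rightarrow> bool" where
  "loose_list es \<longleftrightarrow> distinct es \<and> (\<forall>i j. i < j \<and> j < length es \<longrightarrow>
     (if j = Suc i then card (es ! i \<inter> es ! j) = 1 else es ! i \<inter> es ! j = {}))"

lemma loose_list_rev:
  assumes "loose_list es"
  shows "loose_list (rev es)"
  unfolding loose_list_def
proof (intro conjI allI impI)
  show "distinct (rev es)" using assms by (simp add: loose_list_def)
  fix i j assume ij: "i < j \<and> j < length (rev es)"
  define i' j' where "i' = length es - Suc j" and "j' = length es - Suc i"
  have "i' < j'" "j' < length es" "j' = Suc i' \<longleftrightarrow> j = Suc i"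
    using ij by (auto simp: i'_def j'_def)
  moreover have "rev es ! i = es ! j'" "rev es ! j = es ! i'"
    using ij by (auto simp: rev_nth i'_def j'_def)
  ultimately show "if j = Suc i then card (rev es ! i \<inter> rev es ! j) = 1
      else rev es ! i \<inter> rev es ! j = {}"
    using assms unfolding loose_list_def by (metis Int_commute)
qed

context hypertree
begin

text \<open>The bound on the union leaves \<open>y\<close> as the only common vertex of
  \<open>f\<close> and the list. If \<open>y\<close> also lay in an edge before the last, that edge,
  the last one and \<open>f\<close> would form a branch vertex at \<open>y\<close>.\<close>

lemma loose_list_extend:
  assumes loose: "loose_list es" and sub: "set es \<subseteq> {e \<in> E. nonpendant E e}"
    and cd: "card (\<Union>(set es)) \<le> 1 + length es * (k - 1)"
    and f: "f \<in> E" "nonpendant E f" "f \<notin> set es" and y: "y \<in> f" "y \<in> last es" and ne: "es \<noteq> []"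
    and nb: "\<not> branch_vertex E"
  shows "loose_list (es @ [f]) \<and> card (\<Union>(set (es @ [f]))) \<le> 1 + length (es @ [f]) * (k - 1)"
proof
  define n where "n = length es - 1"
  have len: "length es = Suc n" and last: "last es = es ! n"
    using ne by (auto simp: n_def last_conv_nth)
  have "card (set es) = length es" using loose distinct_card unfolding loose_list_def by blast
  then have c1: "card (f \<inter> \<Union>(set es)) \<le> 1"
    using card_Int_Union_le_1[of "set es" f] sub cd f by auto
  have only: "z = y" if "z \<in> f" "z \<in> es ! i" "i \<le> n" for z i
  proof -
    have "z \<in> f \<inter> \<Union>(set es)" "y \<in> f \<inter> \<Union>(set es)"
      using that y last_in_set[OF ne] len by (auto simp: less_Suc_eq_le)
    moreover have "finite (f \<inter> \<Union>(set es))" using f finite_edge by blast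
    ultimately show ?thesis using c1 card_le_Suc0_iff_eq[of "f \<inter> \<Union>(set es)"] by simp
  qed
  have ndis: "y \<notin> es ! i" if "i < n" for i
  proof
    assume yi: "y \<in> es ! i"
    have "es ! i \<inter> es ! n \<noteq> {}" using yi y last by auto
    then have "n = Suc i" using loose that len unfolding loose_list_def by (metis lessI)
    have mem: "es ! i \<in> set es" "es ! n \<in> set es" using that len by auto
    have "es ! i \<noteq> es ! n" using loose that len
      unfolding loose_list_def by (simp add: nth_eq_iff_index_eq)
    moreover have "es ! i \<noteq> f" "es ! n \<noteq> f" using mem f by auto
    moreover have "es ! i \<in> E" "es ! n \<in> E" "nonpendant E (es ! i)" "nonpendant E (es ! n)"
      using mem sub by auto
    ultimately have "branch_vertex E"
      using f y yi last by (intro branch_vertexI[of "es ! i" E "es ! n" f y]) simp_all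
    then show False using nb by blast
  qed
  have fi: "f \<inter> es ! i = (if i = n then {y} else {})" if "i \<le> n" for i
  proof (cases "i = n")
    case True
    have "z = y" if "z \<in> f" "z \<in> es ! n" for z using only that by blast
    then have "f \<inter> es ! n = {y}" using y unfolding last by blast
    then show ?thesis using True by simp
  next
    case False
    then have "y \<notin> es ! i" using ndis that by simp
    then have "f \<inter> es ! i = {}" using only[OF _ _ that] by blast
    then show ?thesis using False by simp
  qed
  show "loose_list (es @ [f])"
    unfolding loose_list_def
  proof (intro conjI allI impI)
    show "distinct (es @ [f])" using loose f by (simp add: loose_list_def)
    fix i j assume ij: "i < j \<and> j < length (es @ [f])"
    show "if j = Suc i then card ((es @ [f]) ! i \<inter> (es @ [f]) ! j) = 1
        else (es @ [f]) ! i \<inter> (es @ [f]) ! j = {}"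
    proof (cases "j = Suc n")
      case True
      then have "(es @ [f]) ! i \<inter> (es @ [f]) ! j = f \<inter> es ! i" "i \<le> n"
        using ij len by (auto simp: nth_append)
      then show ?thesis using fi[of i] True by auto
    next
      case False
      then show ?thesis using loose ij len by (simp add: nth_append loose_list_def)
    qed
  qed
  have "card (\<Union>(insert f (set es))) \<le> card (\<Union>(set es)) + (k - 1)"
    using card_Union_insert_le[of "set es" f] sub f y last_in_set[OF ne] by blast
  then show "card (\<Union>(set (es @ [f]))) \<le> 1 + length (es @ [f]) * (k - 1)"
    using cd by simp
qed

text \<open>Let \<open>S\<close> be the union of all edges that touch \<open>A\<close>. An edge
  leaving \<open>S\<close> would meet some touching edge \<open>g\<close> at a vertex off
  \<open>A\<close>; then \<open>g\<close> has two branching vertices, so it is a non-pendant edge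
  touching \<open>A\<close>. Without such edges outside \<open>A\<close>, \<open>S\<close> is closed
  and equals \<open>V\<close>.\<close>

lemma nonpendant_connected:
  assumes "A \<subseteq> {e \<in> E. nonpendant E e}" "A \<noteq> {}" "b \<in> E" "nonpendant E b" "b \<notin> A"
  shows "\<exists>f\<in>E. nonpendant E f \<and> f \<notin> A \<and> f \<inter> \<Union>A \<noteq> {}"
proof (rule ccontr)
  assume no: "\<not> ?thesis"
  define S where "S = \<Union>{g \<in> E. g \<inter> \<Union>A \<noteq> {}}"
  have key: "h \<inter> \<Union>A \<noteq> {}" if h: "h \<in> E" and z: "z \<in> h" "z \<in> S" for h z
  proof (rule ccontr)
    assume dis: "\<not> ?thesis"
    obtain g y where g: "g \<in> E" "y \<in> g" "y \<in> \<Union>A" "z \<in> g" using z S_def by blast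
    have zy: "z \<noteq> y" "h \<noteq> g" using dis z g by blast+
    have gA: "g \<notin> A" using dis z g by blast
    obtain a where a: "a \<in> A" "y \<in> a" using g by blast
    then have "a \<in> E" "a \<noteq> g" using assms(1) gA by auto
    then have "deg2 E y" using a g by (intro deg2I[of a _ g]) auto
    moreover have "deg2 E z" using h g z zy by (intro deg2I[of h _ g])
    ultimately have "nonpendant E g" using g zy by (intro nonpendantI[of z _ y])
    then show False using no g gA by blast
  qed
  have AS: "\<Union>A \<subseteq> S" unfolding S_def using assms(1) by blast
  have "S = V"
  proof (rule hconnD[OF conn])
    show "S \<subseteq> V" unfolding S_def using edge_subset by blast
    obtain a where "a \<in> A" using assms(2) by blast
    then have "a \<noteq> {}" "a \<subseteq> S" using assms(1) edge_nonempty AS by auto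
    then show "S \<noteq> {}" by blast
    fix h assume h: "h \<in> E" "h \<inter> S \<noteq> {}"
    then have "h \<inter> \<Union>A \<noteq> {}" using key by blast
    then show "h \<subseteq> S" unfolding S_def using h by blast
  qed
  then have "b \<subseteq> S" using edge_subset[OF assms(3)] by simp
  then have "b \<inter> \<Union>A \<noteq> {}" using key[OF assms(3)] edge_nonempty[OF assms(3)] by auto
  then show False using no assms(3-5) by blast
qed

text \<open>A longest loose path of non-pendant edges: a further non-pendant edge meeting it at an interior
  edge creates a branch vertex or a branch edge, and one meeting it at an end prolongs it.\<close>

lemma loose_list_nonpendant:
  assumes nv: "\<not> branch_vertex E" and nedge: "\<not> branch_edge E"
  shows "\<exists>es. loose_list es \<and> set es = {e \<in> E. nonpendant E e}"
proof -
  let ?N = "{e \<in> E. nonpendant E e}"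
  \<comment> \<open>The union bound is an inequality so that the empty list satisfies
    \<open>Q\<close> and a longest list exists.\<close>
  define Q where "Q es \<longleftrightarrow> loose_list es \<and> set es \<subseteq> ?N \<and> card (\<Union>(set es)) \<le> 1 + length es * (k - 1)"
    for es
  have finN: "finite ?N" using finite_edges by simp
  have "Q []" by (simp add: Q_def loose_list_def)
  moreover have "length es \<le> card ?N" if "Q es" for es
    using that finN card_mono[of ?N "set es"] distinct_card[of es]
    unfolding Q_def loose_list_def by simp
  ultimately obtain es where es: "Q es" "\<And>es'. Q es' \<Longrightarrow> length es' \<le> length es"
    using ex_has_greatest_nat[of Q "[]" length "Suc (card ?N)"] le_imp_less_Suc by blast
  have "set es = ?N"
  proof (rule ccontr)
    assume "set es \<noteq> ?N"
    then obtain b where b: "b \<in> ?N" "b \<notin> set es" using es(1) Q_def by blast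
    have ne: "es \<noteq> []"
    proof
      assume "es = []"
      moreover have "Q [b]" using b card_edge[of b] k_ge_3 by (auto simp: Q_def loose_list_def)
      ultimately show False using es(2)[of "[b]"] by simp
    qed
    \<comment> \<open>Formulated for a rearrangement \<open>es'\<close> so that it serves both ends:
      \<open>es\<close> itself and its reversal.\<close>
    have ext: False if "Q es'" "set es' = set es" "length es' = length es" "f \<in> E" "nonpendant E f" "f \<notin> set es"
        "y \<in> f" "y \<in> last es'" for es' f y
    proof -
      have "es' \<noteq> []" using that ne by auto
      then have "loose_list (es' @ [f]) \<and> card (\<Union>(set (es' @ [f]))) \<le> 1 + length (es' @ [f]) * (k - 1)"
        using that nv unfolding Q_def by (intro loose_list_extend[of _ _ y]) auto
      then have "Q (es' @ [f])" using that unfolding Q_def by auto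
      then show False using es(2) that(3) by fastforce
    qed
    have "set es \<subseteq> ?N" using es(1) Q_def by blast
    then obtain f where f: "f \<in> E" "nonpendant E f" "f \<notin> set es" "f \<inter> \<Union>(set es) \<noteq> {}"
      using nonpendant_connected[OF \<open>set es \<subseteq> ?N\<close> _ _ _ b(2)] ne b(1) by (simp only: mem_Collect_eq) (metis set_empty)
    from f(4) obtain y g where "y \<in> f" "y \<in> g" "g \<in> set es" by blast
    then obtain i where y: "y \<in> f" "y \<in> es ! i" "i < length es" by (metis in_set_conv_nth)
    have mem: "es ! j \<in> E" "nonpendant E (es ! j)" if "j < length es" for j
      using subsetD[OF \<open>set es \<subseteq> ?N\<close> nth_mem[OF that]] by simp_all
    have loose: "loose_list es" using es(1) Q_def by blast
    consider "i = length es - 1" | "i = 0" | j where "i = Suc j" "Suc i < length es"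
      using y(3) by (metis Suc_lessI diff_Suc_1 not0_implies_Suc)
    then show False
    proof cases
      case 1
      then show False using ext[OF es(1), of f y] f y ne by (simp add: last_conv_nth)
    next
      case 2
      have "Q (rev es)" using es(1) loose_list_rev unfolding Q_def by auto
      then show False using ext[of "rev es" f y] f y ne 2 by (simp add: last_rev hd_conv_nth)
    next
      case 3
      let ?e = "es ! i" and ?p = "es ! j" and ?q = "es ! Suc i"
      have jl: "j < length es" using 3 by simp
      have ca: "card (?p \<inter> ?e) = 1" "card (?e \<inter> ?q) = 1" and pq: "?p \<inter> ?q = {}"
        using loose jl y(3) 3 unfolding loose_list_def
        by (metis lessI less_SucI n_not_Suc_n less_Suc_eq)+
      obtain a where a: "a \<in> ?p" "a \<in> ?e" using ca(1) by (metis IntE card.empty ex_in_conv zero_neq_one)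
      obtain c where c: "c \<in> ?q" "c \<in> ?e" using ca(2) by (metis IntE card.empty ex_in_conv zero_neq_one)
      have ds: "distinct es" using loose unfolding loose_list_def by blast
      have dist: "?e \<noteq> ?p" "?e \<noteq> ?q" "?p \<noteq> ?q"
        using nth_eq_iff_index_eq[OF ds] jl y(3) 3 by simp_all
      have "?e \<noteq> f" "?p \<noteq> f" "?q \<noteq> f"
        using f(3) nth_mem[OF y(3)] nth_mem[OF jl] nth_mem[OF 3(2)] by metis+
      note dist = dist this
      have ac: "a \<noteq> c" using pq a c by blast
      note m = mem[OF jl] mem[OF y(3)] mem[OF 3(2)] f(1,2)
      show False
      proof (cases "y = a \<or> y = c")
        case True
        then show False
        proof
          assume "y = a"
          then have "branch_vertex E" using m dist a y(1,2)
            by (intro branch_vertexI[of ?e E "?p" f y]) simp_all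
          then show False using nv by blast
        next
          assume "y = c"
          then have "branch_vertex E" using m dist c y(1,2)
            by (intro branch_vertexI[of ?e E "?q" f y]) simp_all
          then show False using nv by blast
        qed
      next
        case False
        have "branch_edge E" unfolding branch_edge_def
          using m dist a c y(1,2) ac False
          by (intro exI[of _ ?e] exI[of _ a] exI[of _ c] exI[of _ y] exI[of _ ?p] exI[of _ ?q] exI[of _ f])
            (simp add: eq_commute)
        then show False using nedge by blast
      qed
    qed
  qed
  then show ?thesis using es(1) Q_def by blast
qed

lemma deg2_iff_card:
  assumes "v \<in> e" "e \<in> E"
  shows "deg2 E v \<longleftrightarrow> card {e \<in> E. v \<in> e} \<noteq> 1"
proof -
  have "finite {e \<in> E. v \<in> e}" "{e \<in> E. v \<in> e} \<noteq> {}" using finite_edges assms by auto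
  then have "card {e \<in> E. v \<in> e} \<noteq> 0" by simp
  then have "card {e \<in> E. v \<in> e} \<noteq> 1 \<longleftrightarrow> \<not> card {e \<in> E. v \<in> e} \<le> Suc 0" by linarith
  also have "\<dots> \<longleftrightarrow> deg2 E v"
    unfolding card_le_Suc0_iff_eq[OF \<open>finite {e \<in> E. v \<in> e}\<close>] deg2_def by blast
  finally show ?thesis by simp
qed

end

text \<open>Without branching all non-pendant edges form one loose list. Since the edges cover the
  vertex set, \<open>remove_pendant\<close> keeps exactly the vertices of these edges, so it yields
  a loose path and \<open>G\<close> would be a caterpillar.\<close>

lemma branch_of_NC:
  assumes "G \<in> NC k m" "3 \<le> k" "1 \<le> m"
  shows "hypertree k (verts G) (edges G)" "branch_vertex (edges G) \<or> branch_edge (edges G)"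
proof -
  have G: "uniform_hypergraph k G" "supertree G" "\<not> caterpillar G" "card (edges G) = m"
    using assms(1) unfolding NC_def by auto
  then have "edges G \<noteq> {}" using assms(3) by auto
  then show "hypertree k (verts G) (edges G)" using G assms by (intro hypertree_of_supertree)
  then interpret hypertree k "verts G" "edges G" .
  let ?N = "{e \<in> edges G. nonpendant (edges G) e}"
  show "branch_vertex (edges G) \<or> branch_edge (edges G)"
  proof (rule ccontr)
    assume "\<not> ?thesis"
    then obtain es where es: "loose_list es" "set es = ?N"
      using loose_list_nonpendant by blast
    have pend: "nonpendant (edges G) e \<longleftrightarrow> \<not> pendant_edge G e" if e: "e \<in> edges G" for e
    proof -
      let ?D = "{v \<in> e. deg2 (edges G) v}"
      have "?D = {v \<in> e. vertex_degree G v \<noteq> 1}"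
        unfolding vertex_degree_def using deg2_iff_card e by blast
      moreover have "finite ?D" using finite_edge e by simp
      ultimately show ?thesis
        unfolding pendant_edge_def nonpendant_def using e card_le_Suc0_iff_eq[of ?D] by auto
    qed
    then have N: "{e \<in> edges G. \<not> pendant_edge G e} = ?N" by blast
    have E: "edges (remove_pendant G) = ?N"
      and Vr: "verts (remove_pendant G) = verts G - (\<Union>(edges G) - \<Union>?N)"
      unfolding remove_pendant_def Let_def N by simp_all
    have UE: "\<Union>(edges G) = verts G" by (rule Union_edges) fact
    have UN: "\<Union>?N \<subseteq> verts G" using edge_subset by blast
    have "verts (remove_pendant G) = \<Union>?N"
      unfolding Vr UE by (rule double_diff[OF UN order_refl])
    then have "loose_path (remove_pendant G)"
      unfolding loose_path_def E
      using es(1)[unfolded loose_list_def] es(2) by (intro conjI disjI1 exI[of _ es]) simp_all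
    then show False using G(2,3) unfolding caterpillar_def by simp
  qed
qed

section \<open>The spectral radius as a maximum\<close>

text \<open>Polymorphic in the field because arbitrary eigenvectors are complex while Perron vectors
  are real.\<close>

definition edge_operator ::
    "nat \<Rightarrow> real \<Rightarrow> 'a set set \<Rightarrow> ('a \<Rightarrow> 'b::real_normed_field) \<Rightarrow> 'a \<Rightarrow> 'b" where
  "edge_operator k \<alpha> E x v =
     (\<Sum>e | e \<in> E \<and> v \<in> e. of_real \<alpha> * x v ^ (k - 1) + of_real (1 - \<alpha>) * (\<Prod>w\<in>e - {v}. x w))"

text \<open>This is \<open>\<A>\<^sub>\<alpha> x\<^sup>k\<close>, with the degree term distributed over the edges.\<close>

definition edge_form :: "nat \<Rightarrow> real \<Rightarrow> 'a set set \<Rightarrow> ('a \<Rightarrow> real) \<Rightarrow> real" where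
  "edge_form k \<alpha> E x =
     (\<Sum>e\<in>E. \<alpha> * (\<Sum>z\<in>e. x z ^ k) + (1 - \<alpha>) * real k * (\<Prod>z\<in>e. x z))"

context uniform_edges
begin

text \<open>An edge at \<open>v\<close> arises from the \<open>fact (k - 1)\<close> orderings of its
  other vertices, which cancels the normalisation of the adjacency tensor. The degree tensor sees
  only the constant list \<open>replicate (k - 1) v\<close>.\<close>

lemma tensor_apply_eq:
  assumes v: "v \<in> V"
  shows "tensor_apply V k (A_tensor k \<alpha> (Hypergraph V E)) x v = edge_operator k \<alpha> E x v"
proof -
  let ?L = "{ws. set ws \<subseteq> V \<and> length ws = k - 1}"
  let ?d = "card {e \<in> E. v \<in> e}"
  let ?G = "Hypergraph V E"
  have finL: "finite ?L" using finite_verts by (rule finite_lists_length_eq)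
  have deg: "degree_tensor ?G (v # ws) = (if ws = replicate (k - 1) v then real ?d else 0)"
    if "ws \<in> ?L" for ws
  proof -
    have "set ws \<subseteq> {v} \<longleftrightarrow> ws = replicate (k - 1) v"
      using that k_ge_3 by (auto intro!: replicate_eqI)
    then show ?thesis
      by (auto simp: degree_tensor_def vertex_degree_def)
  qed
  have "(\<Sum>ws\<in>?L. of_real (degree_tensor ?G (v # ws)) * (\<Prod>w\<leftarrow>ws. x w)) =
      (\<Sum>ws\<in>?L. if ws = replicate (k - 1) v then of_nat ?d * x v ^ (k - 1) else 0)"
    by (intro sum.cong refl) (auto simp: deg)
  also have "\<dots> = of_nat ?d * x v ^ (k - 1)"
    using finL v by (subst sum.delta) auto
  finally have s1: "(\<Sum>ws\<in>?L. of_real (degree_tensor ?G (v # ws)) * (\<Prod>w\<leftarrow>ws. x w)) =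
      of_nat ?d * x v ^ (k - 1)" .
  have perm: "{ws \<in> ?L. insert v (set ws) \<in> E} =
      (\<Union>e\<in>{e \<in> E. v \<in> e}. permutations_of_set (e - {v}))"
  proof (intro set_eqI iffI)
    fix ws assume "ws \<in> {ws \<in> ?L. insert v (set ws) \<in> E}"
    then have ws: "set ws \<subseteq> V" "length ws = k - 1" "insert v (set ws) \<in> E" by auto
    have "card (set (v # ws)) = length (v # ws)"
      using card_edge[OF ws(3)] ws(2) k_ge_3 by simp
    then have "distinct (v # ws)" by (rule card_distinct)
    then have "ws \<in> permutations_of_set (insert v (set ws) - {v})" by auto
    then show "ws \<in> (\<Union>e\<in>{e \<in> E. v \<in> e}. permutations_of_set (e - {v}))"
      using ws(3) by blast
  next
    fix ws assume "ws \<in> (\<Union>e\<in>{e \<in> E. v \<in> e}. permutations_of_set (e - {v}))"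
    then obtain e where e: "e \<in> E" "v \<in> e" "set ws = e - {v}" "distinct ws"
      by (auto dest: permutations_of_setD)
    then have "length ws = k - 1"
      using distinct_card[of ws] card_edge finite_edge by simp
    moreover have "set ws \<subseteq> V" using e edge_subset by auto
    moreover have "insert v (set ws) = e" using e by blast
    ultimately show "ws \<in> {ws \<in> ?L. insert v (set ws) \<in> E}" using e by simp
  qed
  have "(\<Sum>ws\<in>?L. of_real (adjacency_tensor k ?G (v # ws)) * (\<Prod>w\<leftarrow>ws. x w)) =
      (\<Sum>ws\<in>?L. if insert v (set ws) \<in> E then (\<Prod>w\<leftarrow>ws. x w) / fact (k - 1) else 0)"
    by (intro sum.cong refl) (simp add: adjacency_tensor_def)
  also have "\<dots> = (\<Sum>ws\<in>{ws \<in> ?L. insert v (set ws) \<in> E}. (\<Prod>w\<leftarrow>ws. x w) / fact (k - 1))"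
    using finL by (subst sum.inter_filter) auto
  also have "\<dots> = (\<Sum>e\<in>{e \<in> E. v \<in> e}. \<Sum>ws\<in>permutations_of_set (e - {v}).
      (\<Prod>w\<leftarrow>ws. x w) / fact (k - 1))"
    unfolding perm
  proof (rule sum.UNION_disjoint)
    show "\<forall>i\<in>{e \<in> E. v \<in> e}. \<forall>j\<in>{e \<in> E. v \<in> e}. i \<noteq> j \<longrightarrow>
        permutations_of_set (i - {v}) \<inter> permutations_of_set (j - {v}) = {}"
    proof (intro ballI impI)
      fix i j assume i: "i \<in> {e \<in> E. v \<in> e}" and j: "j \<in> {e \<in> E. v \<in> e}" and "i \<noteq> j"
      then have "i - {v} \<noteq> j - {v}" by (metis (mono_tags, lifting) CollectD insert_Diff)
      then show "permutations_of_set (i - {v}) \<inter> permutations_of_set (j - {v}) = {}"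
        unfolding permutations_of_set_def by blast
    qed
  qed (use finite_edges in auto)
  also have "\<dots> = (\<Sum>e\<in>{e \<in> E. v \<in> e}. \<Prod>w\<in>e - {v}. x w)"
  proof (intro sum.cong refl)
    fix e assume e: "e \<in> {e \<in> E. v \<in> e}"
    have "(\<Sum>ws\<in>permutations_of_set (e - {v}). (\<Prod>w\<leftarrow>ws. x w) / fact (k - 1)) =
        (\<Sum>ws\<in>permutations_of_set (e - {v}). (\<Prod>w\<in>e - {v}. x w) / fact (k - 1))"
    proof (intro sum.cong refl)
      fix ws assume "ws \<in> permutations_of_set (e - {v})"
      then have "set ws = e - {v}" "distinct ws" by (auto dest: permutations_of_setD)
      then show "(\<Prod>w\<leftarrow>ws. x w) / fact (k - 1) = (\<Prod>w\<in>e - {v}. x w) / fact (k - 1)"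
        using prod.distinct_set_conv_list[of ws x] by simp
    qed
    also have "card (e - {v}) = k - 1" using e card_edge finite_edge by simp
    then have "(\<Sum>ws\<in>permutations_of_set (e - {v}). (\<Prod>w\<in>e - {v}. x w) / fact (k - 1)) =
        (\<Prod>w\<in>e - {v}. x w)"
      using e finite_edge by (simp add: card_permutations_of_set)
    finally show "(\<Sum>ws\<in>permutations_of_set (e - {v}). (\<Prod>w\<leftarrow>ws. x w) / fact (k - 1)) =
        (\<Prod>w\<in>e - {v}. x w)" .
  qed
  finally have s2: "(\<Sum>ws\<in>?L. of_real (adjacency_tensor k ?G (v # ws)) * (\<Prod>w\<leftarrow>ws. x w)) =
      (\<Sum>e\<in>{e \<in> E. v \<in> e}. \<Prod>w\<in>e - {v}. x w)" .
  have "tensor_apply V k (A_tensor k \<alpha> ?G) x v =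
      of_real \<alpha> * (\<Sum>ws\<in>?L. of_real (degree_tensor ?G (v # ws)) * (\<Prod>w\<leftarrow>ws. x w)) +
      of_real (1 - \<alpha>) * (\<Sum>ws\<in>?L. of_real (adjacency_tensor k ?G (v # ws)) * (\<Prod>w\<leftarrow>ws. x w))"
    unfolding tensor_apply_def A_tensor_def
    by (simp add: sum_distrib_left algebra_simps sum.distrib sum_subtractf)
  then show ?thesis unfolding s1 s2 edge_operator_def
    by (simp add: sum.distrib sum_distrib_left)
qed

text \<open>Double counting of incidences: the product over an edge appears once for each of its
  vertices, which is the origin of the factor \<open>k\<close> in \<open>edge_form\<close>.\<close>

lemma sum_edge_operator:
  "(\<Sum>v\<in>V. x v * edge_operator k \<alpha> E x v) = edge_form k \<alpha> E x" for x :: "'a \<Rightarrow> real"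
proof -
  let ?h = "\<lambda>v e. x v * (\<alpha> * x v ^ (k - 1) + (1 - \<alpha>) * (\<Prod>w\<in>e - {v}. x w))"
  have "(\<Sum>v\<in>V. x v * edge_operator k \<alpha> E x v) = (\<Sum>v\<in>V. \<Sum>e | e \<in> E \<and> v \<in> e. ?h v e)"
    unfolding edge_operator_def by (simp add: sum_distrib_left)
  also have "\<dots> = (\<Sum>e\<in>E. \<Sum>v | v \<in> V \<and> v \<in> e. ?h v e)"
    by (rule sum.swap_restrict[OF finite_verts finite_edges])
  also have "\<dots> = edge_form k \<alpha> E x"
    unfolding edge_form_def
  proof (intro sum.cong refl)
    fix e assume e: "e \<in> E"
    have "{v. v \<in> V \<and> v \<in> e} = e" using edge_subset[OF e] by blast
    moreover have "?h v e = \<alpha> * x v ^ k + (1 - \<alpha>) * (\<Prod>z\<in>e. x z)" if "v \<in> e" for v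
    proof -
      have "(\<Prod>z\<in>e. x z) = x v * (\<Prod>w\<in>e - {v}. x w)"
        using finite_edge[OF e] that by (rule prod.remove)
      moreover have "x v ^ k = x v * x v ^ (k - 1)"
        using k_ge_3 by (metis Suc_diff_1 not_numeral_le_zero not_gr_zero power_Suc)
      ultimately show ?thesis by (simp add: algebra_simps)
    qed
    ultimately have "(\<Sum>v | v \<in> V \<and> v \<in> e. ?h v e) =
        (\<Sum>v\<in>e. \<alpha> * x v ^ k + (1 - \<alpha>) * (\<Prod>z\<in>e. x z))"
      by (intro sum.cong) auto
    then show "(\<Sum>v | v \<in> V \<and> v \<in> e. ?h v e) =
        \<alpha> * (\<Sum>z\<in>e. x z ^ k) + (1 - \<alpha>) * real k * (\<Prod>z\<in>e. x z)"
      using card_edge[OF e] by (simp add: sum.distrib sum_distrib_left)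
  qed
  finally show ?thesis .
qed

section \<open>Variational characterisation of the spectral radius\<close>

lemma edge_form_scale: "edge_form k \<alpha> E (\<lambda>v. c * x v) = c ^ k * edge_form k \<alpha> E x"
proof -
  have "\<alpha> * (\<Sum>z\<in>e. (c * x z) ^ k) + (1 - \<alpha>) * real k * (\<Prod>z\<in>e. c * x z) =
      c ^ k * (\<alpha> * (\<Sum>z\<in>e. x z ^ k) + (1 - \<alpha>) * real k * (\<Prod>z\<in>e. x z))" if "e \<in> E" for e
    using card_edge[OF that]
    by (simp add: power_mult_distrib prod.distrib sum_distrib_left algebra_simps)
  then show ?thesis unfolding edge_form_def by (simp add: sum_distrib_left)
qed

lemma edge_form_cong:
  assumes "\<And>v. v \<in> V \<Longrightarrow> x v = y v"
  shows "edge_form k \<alpha> E x = edge_form k \<alpha> E y"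
proof -
  have "x v = y v" if "e \<in> E" "v \<in> e" for e v using assms edge_subset that by blast
  then show ?thesis unfolding edge_form_def
    by (intro sum.cong arg_cong2[where f = "(+)"] arg_cong[where f = "\<lambda>t. _ * t"] prod.cong) auto
qed

text \<open>Compactness gives a maximum on the nonnegative part of the unit sphere of the k-norm;
  homogeneity of degree \<open>k\<close> extends the bound to all nonnegative vectors.\<close>

lemma ex_maximizer:
  assumes "V \<noteq> {}"
  shows "\<exists>x. (\<forall>v. 0 \<le> x v) \<and> (\<Sum>v\<in>V. x v ^ k) = 1 \<and>
    (\<forall>y. (\<forall>v\<in>V. 0 \<le> y v) \<longrightarrow> edge_form k \<alpha> E y \<le> edge_form k \<alpha> E x * (\<Sum>v\<in>V. y v ^ k))"
proof -
  \<comment> \<open>Vectors are functions on the whole type, so coordinates outside \<open>V\<close>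
    are pinned to 0; every factor of the product is then compact. The bound 1 holds automatically on
    the unit sphere.\<close>
  let ?B = "PiE UNIV (\<lambda>v. if v \<in> V then {0..1::real} else {0})"
  let ?T = "{x. (\<Sum>v\<in>V. x v ^ k) = (1::real)}"
  have coord: "continuous_on A (\<lambda>x::'a \<Rightarrow> real. x v)" for A v
    by (rule continuous_on_subset[OF continuous_on_product_coordinates subset_UNIV])
  have "compactin (product_topology (\<lambda>i. euclidean) UNIV) ?B"
    unfolding compactin_PiE by (simp add: compactin_euclidean_iff)
  then have "compact ?B" unfolding euclidean_product_topology by simp
  moreover have "closed ?T"
    by (intro closed_Collect_eq continuous_intros coord)
  ultimately have compact: "compact (?B \<inter> ?T)" by (rule compact_Int_closed)
  obtain r where r: "r \<in> V" using assms by blast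
  let ?e = "\<lambda>v. if v = r then 1 else 0 :: real"
  have "(\<Sum>v\<in>V. ?e v ^ k) = (\<Sum>v\<in>V. if v = r then 1 else 0)"
    using k_ge_3 by (intro sum.cong) auto
  then have "?e \<in> ?T" using r finite_verts by simp
  moreover have "?e \<in> ?B" using r by (simp add: PiE_iff)
  ultimately have ne: "?B \<inter> ?T \<noteq> {}" by (metis IntI empty_iff)
  have cont: "continuous_on (?B \<inter> ?T) (edge_form k \<alpha> E)"
    unfolding edge_form_def[abs_def] by (intro continuous_intros coord)
  obtain x where x: "x \<in> ?B \<inter> ?T"
    and max: "\<forall>y \<in> ?B \<inter> ?T. edge_form k \<alpha> E y \<le> edge_form k \<alpha> E x"
    using continuous_attains_sup[OF compact ne cont] by (elim bexE)
  have "0 \<le> x v" for v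
  proof -
    have "x v \<in> (if v \<in> V then {0..1} else {0})" using x by (simp add: PiE_iff)
    then show ?thesis by (auto split: if_splits)
  qed
  moreover have "edge_form k \<alpha> E y \<le> edge_form k \<alpha> E x * (\<Sum>v\<in>V. y v ^ k)"
    if y: "\<forall>v\<in>V. 0 \<le> y v" for y
  proof (cases "(\<Sum>v\<in>V. y v ^ k) = 0")
    case True
    then have "\<forall>v\<in>V. y v ^ k = 0"
      using y finite_verts by (subst (asm) sum_nonneg_eq_0_iff) auto
    then have "edge_form k \<alpha> E y = edge_form k \<alpha> E (\<lambda>v. 0 * y v)"
      by (intro edge_form_cong) auto
    then show ?thesis using True k_ge_3 unfolding edge_form_scale by (simp add: power_0_left)
  next
    case False
    define s where "s = (\<Sum>v\<in>V. y v ^ k)"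
    have "s \<ge> 0" unfolding s_def using y by (intro sum_nonneg) simp
    then have "s > 0" using False unfolding s_def by simp
    define c where "c = root k (inverse s)"
    have ck: "c ^ k = inverse s" "c \<ge> 0"
      unfolding c_def using \<open>s > 0\<close> k_ge_3 by auto
    define z where "z = (\<lambda>v. if v \<in> V then c * y v else 0)"
    have zsum: "(\<Sum>v\<in>V. z v ^ k) = 1"
    proof -
      have "(\<Sum>v\<in>V. z v ^ k) = (\<Sum>v\<in>V. c ^ k * y v ^ k)"
        unfolding z_def by (intro sum.cong refl) (simp add: power_mult_distrib)
      also have "\<dots> = c ^ k * s" unfolding s_def by (rule sum_distrib_left[symmetric])
      finally show ?thesis using ck(1) \<open>s > 0\<close> by simp
    qed
    have znn: "0 \<le> z v" for v unfolding z_def using ck y by simp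
    have "z v \<le> 1" if "v \<in> V" for v
    proof -
      have "z v ^ k \<le> (\<Sum>v\<in>V. z v ^ k)" using that finite_verts znn by (intro member_le_sum) auto
      then show ?thesis using zsum k_ge_3 znn by (simp add: power_le_one_iff)
    qed
    then have "z v \<in> (if v \<in> V then {0..1} else {0})" for v
      using znn[of v] by (cases "v \<in> V") (simp_all add: z_def)
    then have "z \<in> ?B \<inter> ?T" using zsum by (simp add: PiE_iff)
    then have "edge_form k \<alpha> E z \<le> edge_form k \<alpha> E x" by (rule bspec[OF max])
    moreover have "edge_form k \<alpha> E z = inverse s * edge_form k \<alpha> E y"
      using edge_form_cong[of z "\<lambda>v. c * y v"] edge_form_scale[of \<alpha> c y] ck by (simp add: z_def)
    ultimately show ?thesis using \<open>s > 0\<close> by (simp add: s_def[symmetric] field_simps)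
  qed
  ultimately show ?thesis using x by (intro exI[of _ x]) auto
qed

text \<open>At \<open>x v = 0\<close> only the one-sided derivative is available, but there all terms are nonnegative.\<close>

lemma eigen_of_maximizer:
  assumes \<alpha>: "0 \<le> \<alpha>" "\<alpha> < 1" and nn: "\<And>v. v \<in> V \<Longrightarrow> 0 \<le> x v"
    and bound: "\<And>y. (\<forall>v\<in>V. 0 \<le> y v) \<Longrightarrow> edge_form k \<alpha> E y \<le> \<rho> * (\<Sum>v\<in>V. y v ^ k)"
    and eq: "edge_form k \<alpha> E x = \<rho> * (\<Sum>v\<in>V. x v ^ k)" and v: "v \<in> V"
  shows "edge_operator k \<alpha> E x v = \<rho> * x v ^ (k - 1)"
proof -
  define c where "c = (\<Sum>e | e \<in> E \<and> v \<in> e. \<Prod>w\<in>e - {v}. x w)"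
  define d where "d = real (card {e \<in> E. v \<in> e})"
  have op: "edge_operator k \<alpha> E x v = \<alpha> * d * x v ^ (k - 1) + (1 - \<alpha>) * c"
    unfolding edge_operator_def c_def d_def by (simp add: sum.distrib sum_distrib_left)
  define A where "A = (\<Sum>e | e \<in> E \<and> v \<in> e. \<alpha> * (\<Sum>z\<in>e - {v}. x z ^ k)) +
    (\<Sum>e | e \<in> E \<and> v \<notin> e. \<alpha> * (\<Sum>z\<in>e. x z ^ k) + (1 - \<alpha>) * real k * (\<Prod>z\<in>e. x z))"
  define B where "B = (\<Sum>z\<in>V - {v}. x z ^ k)"
  let ?y = "\<lambda>t. x(v := t)"
  \<comment> \<open>As a function of the single coordinate at \<open>v\<close>, the form is a
    polynomial with one term of degree \<open>k\<close> and one linear term.\<close>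
  have form: "edge_form k \<alpha> E (?y t) = \<alpha> * d * t ^ k + (1 - \<alpha>) * real k * c * t + A" for t
  proof -
    let ?f = "\<lambda>y e. \<alpha> * (\<Sum>z\<in>e. y z ^ k) + (1 - \<alpha>) * real k * (\<Prod>z\<in>e. y z)"
    have split: "{e \<in> E. v \<in> e} \<union> {e \<in> E. v \<notin> e} = E" by blast
    have "edge_form k \<alpha> E (?y t) =
        (\<Sum>e | e \<in> E \<and> v \<in> e. ?f (?y t) e) + (\<Sum>e | e \<in> E \<and> v \<notin> e. ?f (?y t) e)"
      unfolding edge_form_def using finite_edges
      by (subst sum.union_disjoint[symmetric]) (auto simp: split)
    also have "(\<Sum>e | e \<in> E \<and> v \<notin> e. ?f (?y t) e) = (\<Sum>e | e \<in> E \<and> v \<notin> e. ?f x e)"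
    proof (intro sum.cong refl)
      fix e assume "e \<in> {e \<in> E. v \<notin> e}"
      then have "(?y t) z = x z" if "z \<in> e" for z using that by auto
      then have "(\<Sum>z\<in>e. ?y t z ^ k) = (\<Sum>z\<in>e. x z ^ k)" "(\<Prod>z\<in>e. ?y t z) = (\<Prod>z\<in>e. x z)"
        by (simp_all cong: sum.cong prod.cong)
      then show "?f (?y t) e = ?f x e" by simp
    qed
    also have "(\<Sum>e | e \<in> E \<and> v \<in> e. ?f (?y t) e) =
        (\<Sum>e | e \<in> E \<and> v \<in> e. \<alpha> * t ^ k + \<alpha> * (\<Sum>z\<in>e - {v}. x z ^ k) +
          (1 - \<alpha>) * real k * t * (\<Prod>w\<in>e - {v}. x w))"
    proof (intro sum.cong refl)
      fix e assume e: "e \<in> {e \<in> E. v \<in> e}"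
      have "(\<Sum>z\<in>e. ?y t z ^ k) = t ^ k + (\<Sum>z\<in>e - {v}. x z ^ k)"
        using e finite_edge by (subst sum.remove[of _ v]) auto
      moreover have "(\<Prod>z\<in>e. ?y t z) = t * (\<Prod>z\<in>e - {v}. x z)"
        using e finite_edge by (subst prod.remove[of _ v]) auto
      ultimately show "?f (?y t) e = \<alpha> * t ^ k + \<alpha> * (\<Sum>z\<in>e - {v}. x z ^ k) +
          (1 - \<alpha>) * real k * t * (\<Prod>w\<in>e - {v}. x w)"
        by (simp add: algebra_simps)
    qed
    also have "\<dots> = \<alpha> * d * t ^ k + (\<Sum>e | e \<in> E \<and> v \<in> e. \<alpha> * (\<Sum>z\<in>e - {v}. x z ^ k)) +
        (1 - \<alpha>) * real k * c * t"
      by (simp add: sum.distrib d_def c_def flip: sum_distrib_left)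
    finally show ?thesis unfolding A_def by (simp only: add_ac)
  qed
  have norm: "(\<Sum>z\<in>V. ?y t z ^ k) = t ^ k + B" for t
    unfolding B_def using v finite_verts by (subst sum.remove[of _ v]) auto
  \<comment> \<open>The slack of the bound along this coordinate: nonnegative for nonnegative
    \<open>t\<close> and zero at \<open>x v\<close>. Its derivative there is, up to the factor
    \<open>k\<close>, the defect in the eigenvalue equation.\<close>
  define g where "g t = \<rho> * (t ^ k + B) - (\<alpha> * d * t ^ k + (1 - \<alpha>) * real k * c * t + A)" for t
  have g0: "g t \<ge> 0" if "t \<ge> 0" for t
    using bound[of "?y t"] nn that unfolding g_def form norm by simp
  have gx: "g (x v) = 0"
    using eq form[of "x v"] norm[of "x v"] unfolding g_def by simp
  define D where "D = real k * ((\<rho> - \<alpha> * d) * x v ^ (k - 1) - (1 - \<alpha>) * c)"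
  have der: "(g has_real_derivative D) (at (x v))"
    unfolding g_def[abs_def] D_def by (auto intro!: derivative_eq_intros simp: algebra_simps)
  have "D = 0"
  proof (cases "x v > 0")
    case True
    have "\<forall>y. \<bar>x v - y\<bar> < x v \<longrightarrow> g (x v) \<le> g y" using gx g0 by auto
    then show ?thesis using DERIV_local_min[OF der True] by blast
  next
    case False
    then have x0: "x v = 0" using nn[OF v] by simp
    have "\<not> D < 0"
    proof
      assume "D < 0"
      then obtain \<delta> where \<delta>: "\<delta> > 0" "\<forall>h>0. h < \<delta> \<longrightarrow> g (x v) > g (x v + h)"
        using DERIV_neg_dec_right[OF der] by blast
      then have "g (\<delta> / 2) < 0" using x0 gx by (metis add_0 field_sum_of_halves half_gt_zero less_add_same_cancel1)
      then show False using g0[of "\<delta> / 2"] \<delta> by simp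
    qed
    moreover have "c \<ge> 0"
      unfolding c_def using nn edge_subset by (intro sum_nonneg prod_nonneg) blast
    moreover have Deq: "D = - (real k * (1 - \<alpha>) * c)"
      unfolding D_def x0 using k_ge_3 by (simp add: power_0_left algebra_simps)
    moreover have "real k * (1 - \<alpha>) > 0" using \<alpha> k_ge_3 by simp
    ultimately have "c = 0" using \<alpha>(2) by (auto simp: not_less mult_le_0_iff)
    then show ?thesis using Deq by simp
  qed
  then have "(\<rho> - \<alpha> * d) * x v ^ (k - 1) - (1 - \<alpha>) * c = 0" unfolding D_def using k_ge_3 by simp
  then show ?thesis unfolding op by (simp add: algebra_simps)
qed

text \<open>The triangle inequality turns the eigenvalue equation into an inequality for the
  entrywise moduli; multiplying by the moduli and summing over \<open>V\<close> produces the form,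
  to which the bound applies.\<close>

lemma eigenvalue_le:
  assumes \<alpha>: "0 \<le> \<alpha>" "\<alpha> < 1"
    and bound: "\<And>y. (\<forall>v\<in>V. 0 \<le> y v) \<Longrightarrow> edge_form k \<alpha> E y \<le> \<rho> * (\<Sum>v\<in>V. y v ^ k)"
    and ev: "tensor_eigenvalue V k (A_tensor k \<alpha> (Hypergraph V E)) \<mu>"
  shows "cmod \<mu> \<le> \<rho>"
proof -
  obtain x where x: "\<exists>v\<in>V. x v \<noteq> 0"
    and eig: "\<And>v. v \<in> V \<Longrightarrow> edge_operator k \<alpha> E x v = \<mu> * x v ^ (k - 1)"
    using ev unfolding tensor_eigenvalue_def by (auto simp: tensor_apply_eq)
  let ?y = "\<lambda>v. cmod (x v)"
  have le: "cmod \<mu> * ?y v ^ (k - 1) \<le> edge_operator k \<alpha> E ?y v" if "v \<in> V" for v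
  proof -
    have "cmod \<mu> * ?y v ^ (k - 1) = cmod (edge_operator k \<alpha> E x v)"
      unfolding eig[OF that] by (simp add: norm_mult norm_power)
    also have "\<dots> \<le> edge_operator k \<alpha> E ?y v"
      unfolding edge_operator_def
    proof (rule sum_norm_le)
      fix e assume "e \<in> {e \<in> E. v \<in> e}"
      have "cmod (of_real \<alpha> * x v ^ (k - 1) + of_real (1 - \<alpha>) * (\<Prod>w\<in>e - {v}. x w)) \<le>
          cmod (of_real \<alpha> * x v ^ (k - 1)) + cmod (of_real (1 - \<alpha>) * (\<Prod>w\<in>e - {v}. x w))"
        by (rule norm_triangle_ineq)
      then show "cmod (of_real \<alpha> * x v ^ (k - 1) + of_real (1 - \<alpha>) * (\<Prod>w\<in>e - {v}. x w)) \<le>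
          of_real \<alpha> * ?y v ^ (k - 1) + of_real (1 - \<alpha>) * (\<Prod>w\<in>e - {v}. ?y w)"
        using \<alpha> by (simp add: norm_mult norm_power prod_norm del: of_real_diff)
    qed
    finally show ?thesis .
  qed
  have "cmod \<mu> * (\<Sum>v\<in>V. ?y v ^ k) = (\<Sum>v\<in>V. ?y v * (cmod \<mu> * ?y v ^ (k - 1)))"
  proof -
    have "t ^ k = t * t ^ (k - 1)" for t :: real
      using k_ge_3 by (metis Suc_diff_1 not_numeral_le_zero not_gr_zero power_Suc)
    then show ?thesis by (simp add: sum_distrib_left algebra_simps)
  qed
  also have "\<dots> \<le> (\<Sum>v\<in>V. ?y v * edge_operator k \<alpha> E ?y v)"
    using le by (intro sum_mono mult_left_mono) auto
  also have "\<dots> = edge_form k \<alpha> E ?y" by (rule sum_edge_operator)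
  also have "\<dots> \<le> \<rho> * (\<Sum>v\<in>V. ?y v ^ k)" by (rule bound) auto
  finally have "cmod \<mu> * (\<Sum>v\<in>V. ?y v ^ k) \<le> \<rho> * (\<Sum>v\<in>V. ?y v ^ k)" .
  moreover have "(\<Sum>v\<in>V. ?y v ^ k) > 0"
    using x finite_verts by (auto intro: sum_pos2)
  ultimately show ?thesis by simp
qed

lemma edge_operator_of_real:
  "edge_operator k \<alpha> E (\<lambda>v. complex_of_real (x v)) v = of_real (edge_operator k \<alpha> E x v)"
  unfolding edge_operator_def by simp

text \<open>The maximum of the form is itself an eigenvalue, by \<open>eigen_of_maximizer\<close>,
  and dominates all others, by \<open>eigenvalue_le\<close>; so the supremum in \<open>rho\<close>
  is attained there.\<close>

lemma rho_maximizer: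
  assumes \<alpha>: "0 \<le> \<alpha>" "\<alpha> < 1" and "V \<noteq> {}"
  shows "\<exists>x. (\<forall>v. 0 \<le> x v) \<and> (\<Sum>v\<in>V. x v ^ k) = 1 \<and> edge_form k \<alpha> E x = rho k \<alpha> (Hypergraph V E)"
    and "\<And>y. (\<forall>v\<in>V. 0 \<le> y v) \<Longrightarrow>
      edge_form k \<alpha> E y \<le> rho k \<alpha> (Hypergraph V E) * (\<Sum>v\<in>V. y v ^ k)"
proof -
  obtain x where x: "\<And>v. 0 \<le> x v" "(\<Sum>v\<in>V. x v ^ k) = 1"
    "\<And>y. (\<forall>v\<in>V. 0 \<le> y v) \<Longrightarrow> edge_form k \<alpha> E y \<le> edge_form k \<alpha> E x * (\<Sum>v\<in>V. y v ^ k)"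
    using ex_maximizer[OF assms(3)] by blast
  define \<rho> where "\<rho> = edge_form k \<alpha> E x"
  have bound: "edge_form k \<alpha> E y \<le> \<rho> * (\<Sum>v\<in>V. y v ^ k)" if "\<forall>v\<in>V. 0 \<le> y v" for y
    using x(3)[OF that] unfolding \<rho>_def .
  have eig: "edge_operator k \<alpha> E x v = \<rho> * x v ^ (k - 1)" if "v \<in> V" for v
    by (rule eigen_of_maximizer[OF \<alpha> x(1) bound _ that]) (simp_all add: x(2) \<rho>_def)
  have "\<rho> \<ge> 0"
    unfolding \<rho>_def edge_form_def using \<alpha> x(1)
    by (intro sum_nonneg add_nonneg_nonneg mult_nonneg_nonneg prod_nonneg) auto
  have "\<exists>v\<in>V. x v \<noteq> 0"
  proof (rule ccontr)
    assume "\<not> ?thesis"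
    then have "(\<Sum>v\<in>V. x v ^ k) = 0" using k_ge_3 by simp
    then show False using x(2) by simp
  qed
  then have "tensor_eigenvalue V k (A_tensor k \<alpha> (Hypergraph V E)) (of_real \<rho>)"
    unfolding tensor_eigenvalue_def
    by (intro exI[of _ "\<lambda>v. complex_of_real (x v)"])
      (simp add: tensor_apply_eq edge_operator_of_real eig)
  then have "\<rho> \<in> cmod ` {\<mu>. tensor_eigenvalue V k (A_tensor k \<alpha> (Hypergraph V E)) \<mu>}"
    using \<open>\<rho> \<ge> 0\<close> by (intro image_eqI[of _ _ "of_real \<rho>"]) auto
  then have "rho k \<alpha> (Hypergraph V E) = \<rho>"
    unfolding rho_def hypergraph.sel
  proof (rule cSup_eq_maximum)
    fix t assume "t \<in> cmod ` {\<mu>. tensor_eigenvalue V k (A_tensor k \<alpha> (Hypergraph V E)) \<mu>}"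
    then show "t \<le> \<rho>" using eigenvalue_le[OF \<alpha> bound] by auto
  qed
  then show "\<exists>x. (\<forall>v. 0 \<le> x v) \<and> (\<Sum>v\<in>V. x v ^ k) = 1 \<and> edge_form k \<alpha> E x = rho k \<alpha> (Hypergraph V E)"
    and "\<And>y. (\<forall>v\<in>V. 0 \<le> y v) \<Longrightarrow>
      edge_form k \<alpha> E y \<le> rho k \<alpha> (Hypergraph V E) * (\<Sum>v\<in>V. y v ^ k)"
    using x(1,2) bound \<rho>_def by auto
qed

text \<open>If an edge met the support \<open>S\<close> of \<open>x\<close> without being contained in it, raising \<open>x\<close> to \<open>t\<close> on its
  \<open>j < k\<close> zeros would gain order \<open>t\<^sup>j\<close> in the form but only order \<open>t\<^sup>k\<close> in the norm.\<close>

lemma maximizer_pos: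
  assumes con: "hconn V E" and \<alpha>: "0 \<le> \<alpha>" "\<alpha> < 1" and nn: "\<And>v. 0 \<le> x v"
    and sum1: "(\<Sum>v\<in>V. x v ^ k) = 1"
    and bound: "\<And>y. (\<forall>v\<in>V. 0 \<le> y v) \<Longrightarrow> edge_form k \<alpha> E y \<le> edge_form k \<alpha> E x * (\<Sum>v\<in>V. y v ^ k)"
    and v: "v \<in> V"
  shows "x v > 0"
proof -
  define S where "S = {v \<in> V. x v > 0}"
  have "S = V"
  proof (rule hconnD[OF con])
    show "S \<subseteq> V" unfolding S_def by blast
    show "S \<noteq> {}"
    proof
      assume "S = {}"
      then have "x v = 0" if "v \<in> V" for v using that nn[of v] unfolding S_def by force
      then have "(\<Sum>v\<in>V. x v ^ k) = 0" using k_ge_3 by simp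
      then show False using sum1 by simp
    qed
    fix e assume e: "e \<in> E" "e \<inter> S \<noteq> {}"
    show "e \<subseteq> S"
    proof (rule ccontr)
      assume "\<not> e \<subseteq> S"
      define Z where "Z = e - S"
      define \<rho> where "\<rho> = edge_form k \<alpha> E x"
      have fe: "finite e" using finite_edge e by blast
      have Z: "Z \<noteq> {}" "finite Z" "Z \<subseteq> V" "Z \<subseteq> e"
        using \<open>\<not> e \<subseteq> S\<close> fe edge_subset[OF e(1)] unfolding Z_def by auto
      have xZ: "x z = 0" if "z \<in> Z" for z
        using that nn[of z] edge_subset[OF e(1)] unfolding Z_def S_def by force
      have "card Z < card e"
        using e fe unfolding Z_def by (intro psubset_card_mono) auto
      then have cZ: "card Z < k" using card_edge e by simp
      define c where "c = (1 - \<alpha>) * real k * (\<Prod>z\<in>e \<inter> S. x z)"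
      have "(\<Prod>z\<in>e \<inter> S. x z) > 0" unfolding S_def by (intro prod_pos) auto
      then have "c > 0" unfolding c_def using \<alpha> k_ge_3 by simp
      let ?f = "\<lambda>y e. \<alpha> * (\<Sum>z\<in>e. y z ^ k) + (1 - \<alpha>) * real k * (\<Prod>z\<in>e. y z)"
      have ineq: "c * t ^ card Z \<le> \<rho> * real (card Z) * t ^ k" if t: "t > 0" for t
      proof -
        define y where "y z = (if z \<in> Z then t else x z)" for z
        have yx: "x z \<le> y z" "0 \<le> y z" for z unfolding y_def using xZ nn t by auto
        have mono: "?f x g \<le> ?f y g" for g
          using \<alpha> yx nn k_ge_3
          by (intro add_mono mult_left_mono sum_mono power_mono prod_mono) auto
        have "(\<Prod>z\<in>e. x z) = 0" using Z fe xZ by (subst prod_zero_iff) auto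
        moreover have "(\<Prod>z\<in>e. y z) = (\<Prod>z\<in>e \<inter> S. x z) * t ^ card Z"
        proof -
          have "(\<Prod>z\<in>e. y z) = (\<Prod>z\<in>e \<inter> S. y z) * (\<Prod>z\<in>Z. y z)"
            unfolding Z_def using fe by (subst prod.union_disjoint[symmetric]) (auto simp: Int_Diff_Un)
          also have "(\<Prod>z\<in>e \<inter> S. y z) = (\<Prod>z\<in>e \<inter> S. x z)"
            by (intro prod.cong refl) (auto simp: y_def Z_def)
          also have "(\<Prod>z\<in>Z. y z) = t ^ card Z" by (simp add: y_def)
          finally show ?thesis .
        qed
        moreover have "\<alpha> * (\<Sum>z\<in>e. x z ^ k) \<le> \<alpha> * (\<Sum>z\<in>e. y z ^ k)"
          using \<alpha> yx nn by (intro mult_left_mono sum_mono power_mono) auto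
        ultimately have "?f x e + c * t ^ card Z \<le> ?f y e" unfolding c_def by simp
        moreover have "(\<Sum>g\<in>E - {e}. ?f x g) \<le> (\<Sum>g\<in>E - {e}. ?f y g)"
          using mono by (intro sum_mono)
        ultimately have "\<rho> + c * t ^ card Z \<le> edge_form k \<alpha> E y"
          unfolding \<rho>_def edge_form_def using finite_edges e by (simp add: sum.remove[of E e])
        also have "\<dots> \<le> \<rho> * (\<Sum>v\<in>V. y v ^ k)"
          unfolding \<rho>_def using yx by (intro bound) auto
        also have "(\<Sum>v\<in>V. y v ^ k) = 1 + real (card Z) * t ^ k"
        proof -
          have sp: "(\<Sum>v\<in>V. h v) = (\<Sum>v\<in>V - Z. h v) + (\<Sum>v\<in>Z. h v)" for h :: "'a \<Rightarrow> real"
            using sum.subset_diff[OF Z(3) finite_verts] .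
          have "(\<Sum>v\<in>Z. x v ^ k) = 0" using xZ k_ge_3 by simp
          moreover have "(\<Sum>v\<in>V - Z. y v ^ k) = (\<Sum>v\<in>V - Z. x v ^ k)"
            by (intro sum.cong refl) (simp add: y_def)
          moreover have "(\<Sum>v\<in>Z. y v ^ k) = real (card Z) * t ^ k" by (simp add: y_def)
          ultimately show ?thesis using sum1 sp[of "\<lambda>v. x v ^ k"] sp[of "\<lambda>v. y v ^ k"] by simp
        qed
        finally show ?thesis by (simp add: algebra_simps)
      qed
      \<comment> \<open>After division by \<open>t ^ card Z\<close> a positive power of
        \<open>t\<close> remains on the right, so letting \<open>t\<close> tend to 0 contradicts
        \<open>c > 0\<close>.\<close>
      have ineq': "c \<le> \<rho> * real (card Z) * t ^ (k - card Z)" if t: "t > 0" for t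
      proof -
        have "t ^ k = t ^ (k - card Z) * t ^ card Z" using cZ by (simp flip: power_add)
        then have "c * t ^ card Z \<le> (\<rho> * real (card Z) * t ^ (k - card Z)) * t ^ card Z"
          using ineq[OF t] by simp
        then show ?thesis using t by simp
      qed
      have "((\<lambda>t. \<rho> * real (card Z) * t ^ (k - card Z)) \<longlongrightarrow> \<rho> * real (card Z) * 0 ^ (k - card Z))
          (at_right 0)"
        by (intro tendsto_intros)
      moreover have "\<forall>\<^sub>F t in at_right 0. c \<le> \<rho> * real (card Z) * t ^ (k - card Z)"
        using eventually_at_right_less[of 0] by (rule eventually_mono) (rule ineq')
      ultimately have "c \<le> \<rho> * real (card Z) * 0 ^ (k - card Z)"
        by (rule tendsto_lowerbound) simp
      then show False using \<open>c > 0\<close> cZ by (simp add: power_0_left)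
    qed
  qed
  then show ?thesis using v unfolding S_def by blast
qed

lemma perron_vector:
  assumes "hconn V E" "0 \<le> \<alpha>" "\<alpha> < 1" "V \<noteq> {}"
  shows "\<exists>x. (\<forall>v\<in>V. 0 < x v) \<and> edge_form k \<alpha> E x = rho k \<alpha> (Hypergraph V E) * (\<Sum>v\<in>V. x v ^ k) \<and>
    (\<forall>v\<in>V. edge_operator k \<alpha> E x v = rho k \<alpha> (Hypergraph V E) * x v ^ (k - 1))"
proof -
  note max = rho_maximizer[OF assms(2-4)]
  obtain x where x: "\<And>v. 0 \<le> x v" "(\<Sum>v\<in>V. x v ^ k) = 1"
    "edge_form k \<alpha> E x = rho k \<alpha> (Hypergraph V E)"
    using max(1) by blast
  have "0 < x v" if "v \<in> V" for v
    by (rule maximizer_pos[OF assms(1-3) x(1,2) _ that]) (simp add: max(2) x(3))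
  moreover have "edge_operator k \<alpha> E x v = rho k \<alpha> (Hypergraph V E) * x v ^ (k - 1)" if "v \<in> V" for v
    by (rule eigen_of_maximizer[OF assms(2,3) x(1) max(2) _ that]) (simp_all add: x(2,3))
  ultimately show ?thesis using x(2,3) by (intro exI[of _ x]) simp
qed

end

text \<open>As a test vector for \<open>E'\<close>, \<open>x\<close> gives the weak inequality. If
  the radii agreed, \<open>x\<close> would be a maximiser for \<open>E'\<close> as well and satisfy
  its eigenvalue equation, but at \<open>u\<close> the two operators differ while the right-hand
  sides coincide.\<close>

lemma rho_less:
  assumes E: "uniform_edges k V E" and E': "uniform_edges k V E'" and \<alpha>: "0 \<le> \<alpha>" "\<alpha> < 1"
    and pos: "\<And>v. v \<in> V \<Longrightarrow> 0 < x v"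
    and form: "edge_form k \<alpha> E x = rho k \<alpha> (Hypergraph V E) * (\<Sum>v\<in>V. x v ^ k)"
    and op: "\<And>v. v \<in> V \<Longrightarrow> edge_operator k \<alpha> E x v = rho k \<alpha> (Hypergraph V E) * x v ^ (k - 1)"
    and le: "edge_form k \<alpha> E x \<le> edge_form k \<alpha> E' x"
    and u: "u \<in> V" and less: "edge_operator k \<alpha> E x u < edge_operator k \<alpha> E' x u"
  shows "rho k \<alpha> (Hypergraph V E) < rho k \<alpha> (Hypergraph V E')"
proof -
  interpret uniform_edges k V E by fact
  interpret E': uniform_edges k V E' by fact
  let ?\<rho> = "rho k \<alpha> (Hypergraph V E)" and ?\<rho>' = "rho k \<alpha> (Hypergraph V E')"
  have "V \<noteq> {}" using u by blast
  note max = E'.rho_maximizer(2)[OF \<alpha> this]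
  have s: "(\<Sum>v\<in>V. x v ^ k) > 0"
    using u pos finite_verts by (intro sum_pos) auto
  have nn: "0 \<le> x v" if "v \<in> V" for v using pos[OF that] by simp
  have le': "edge_form k \<alpha> E' x \<le> ?\<rho>' * (\<Sum>v\<in>V. x v ^ k)" using nn by (intro max) simp
  have "?\<rho> * (\<Sum>v\<in>V. x v ^ k) \<le> ?\<rho>' * (\<Sum>v\<in>V. x v ^ k)" using form le le' by linarith
  then have "?\<rho> \<le> ?\<rho>'" using s by simp
  moreover have "?\<rho> \<noteq> ?\<rho>'"
  proof
    assume eq: "?\<rho> = ?\<rho>'"
    then have "edge_form k \<alpha> E' x = ?\<rho>' * (\<Sum>v\<in>V. x v ^ k)"
      using form le le' by (intro order_antisym) simp_all
    from E'.eigen_of_maximizer[OF \<alpha> nn max this u]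
    have "edge_operator k \<alpha> E' x u = ?\<rho> * x u ^ (k - 1)" using eq by simp
    then show False using op[OF u] less by simp
  qed
  ultimately show ?thesis by simp
qed

section \<open>Moving edges\<close>

text \<open>Defined on single edges, so that the new edge set is an image of \<open>E\<close> and
  its cardinality follows from injectivity.\<close>

definition move_edge :: "'a \<Rightarrow> 'a \<Rightarrow> 'a set set \<Rightarrow> 'a set \<Rightarrow> 'a set" where
  "move_edge u w M f = (if f \<in> M then insert u (f - {w}) else f)"

definition perron :: "nat \<Rightarrow> real \<Rightarrow> 'a set \<Rightarrow> 'a set set \<Rightarrow> ('a \<Rightarrow> real) \<Rightarrow> bool" where
  "perron k \<alpha> V E x \<longleftrightarrow> (\<forall>v\<in>V. 0 < x v) \<and>
     edge_form k \<alpha> E x = rho k \<alpha> (Hypergraph V E) * (\<Sum>v\<in>V. x v ^ k) \<and>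
     (\<forall>v\<in>V. edge_operator k \<alpha> E x v = rho k \<alpha> (Hypergraph V E) * x v ^ (k - 1))"

context hypertree
begin

lemma verts_nonempty: "V \<noteq> {}"
  using card_verts by auto

lemma ex_perron: "0 \<le> \<alpha> \<Longrightarrow> \<alpha> < 1 \<Longrightarrow> \<exists>x. perron k \<alpha> V E x"
  unfolding perron_def by (rule perron_vector[OF conn _ _ verts_nonempty])

context
  fixes u w M
  assumes M: "\<And>f. f \<in> M \<Longrightarrow> f \<in> E \<and> w \<in> f \<and> u \<notin> f" and u: "u \<in> V"
begin

text \<open>A moved edge keeps \<open>k - 1\<close>, hence at least two, vertices of the original.
  An unmoved edge equal to it would share them all with the original, against linearity.\<close>

lemma inj_on_move_edge: "inj_on (move_edge u w M) E"
proof (rule inj_onI)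
  have aux: False if "f \<in> M" "g \<in> E" "g \<notin> M" "insert u (f - {w}) = g" for f g
  proof -
    have "f \<in> E" "f \<noteq> g" using M that by auto
    then have "card (f \<inter> g) \<le> 1" using card_Int_le_1 that by blast
    moreover have "card (f - {w}) \<le> card (f \<inter> g)"
      using that finite_edge[OF that(2)] by (intro card_mono) auto
    moreover have "card (f - {w}) = k - 1"
      using M[OF that(1)] card_edge finite_edge by simp
    ultimately show False using k_ge_3 by simp
  qed
  fix f g assume fg: "f \<in> E" "g \<in> E" "move_edge u w M f = move_edge u w M g"
  show "f = g"
  proof (cases "f \<in> M")
    case True
    show ?thesis
    proof (cases "g \<in> M")
      case g: True
      have "insert u (f - {w}) = insert u (g - {w})" using fg True g by (simp add: move_edge_def)
      then have "f - {w} = g - {w}" using M[OF True] M[OF g] by (metis Diff_iff insert_ident)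
      then show ?thesis using M[OF True] M[OF g] by (metis insert_Diff)
    next
      case False
      then show ?thesis using aux[OF True fg(2)] fg(3) True by (simp add: move_edge_def)
    qed
  next
    case f: False
    show ?thesis
    proof (cases "g \<in> M")
      case True
      then show ?thesis using aux[OF True fg(1) f] fg(3) f by (simp add: move_edge_def)
    qed (use fg f in \<open>simp add: move_edge_def\<close>)
  qed
qed

lemma uniform_move_edge: "uniform_edges k V (move_edge u w M ` E)"
proof
  fix e assume "e \<in> move_edge u w M ` E"
  then obtain f where f: "f \<in> E" "e = move_edge u w M f" by blast
  show "e \<subseteq> V" using f edge_subset[OF f(1)] u by (auto simp: move_edge_def)
  show "card e = k"
    using f card_edge[OF f(1)] finite_edge[OF f(1)] M[of f] k_ge_3 by (simp add: move_edge_def)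
qed (use finite_verts k_ge_3 in auto)

lemma hypertree_move_edge:
  assumes "hconn V (move_edge u w M ` E)"
  shows "hypertree k V (move_edge u w M ` E)"
proof -
  interpret uniform_edges k V "move_edge u w M ` E" by (rule uniform_move_edge)
  show ?thesis
    using assms card_verts card_image[OF inj_on_move_edge] by unfold_locales auto
qed

text \<open>Replacing \<open>x w\<close> by the larger \<open>x u\<close> lowers no summand of the
  form, while \<open>u\<close> keeps its old edges and gains at least one, so its operator value
  strictly grows.\<close>

lemma rho_move_edge:
  assumes \<alpha>: "0 \<le> \<alpha>" "\<alpha> < 1" and x: "perron k \<alpha> V E x" and le: "x w \<le> x u" and "M \<noteq> {}"
  shows "rho k \<alpha> (Hypergraph V E) < rho k \<alpha> (Hypergraph V (move_edge u w M ` E))"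
proof -
  let ?m = "move_edge u w M"
  interpret E': uniform_edges k V "?m ` E" by (rule uniform_move_edge)
  obtain f0 where f0: "f0 \<in> M" using \<open>M \<noteq> {}\<close> by blast
  have pos: "0 < x v" if "v \<in> V" for v using x that unfolding perron_def by blast
  have w: "w \<in> V" using M[OF f0] edge_subset by blast
  have pow: "x w ^ k \<le> x u ^ k" using le pos[OF w] by (intro power_mono) auto
  let ?f = "\<lambda>e. \<alpha> * (\<Sum>z\<in>e. x z ^ k) + (1 - \<alpha>) * real k * (\<Prod>z\<in>e. x z)"
  have "edge_form k \<alpha> E x \<le> (\<Sum>f\<in>E. ?f (?m f))"
    unfolding edge_form_def
  proof (rule sum_mono)
    fix f assume f: "f \<in> E"
    show "?f f \<le> ?f (?m f)"
    proof (cases "f \<in> M")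
      case True
      note uw = M[OF True]
      have fin: "finite (f - {w})" "u \<notin> f - {w}" using uw finite_edge by auto
      have nn: "0 \<le> (\<Prod>z\<in>f - {w}. x z)"
        using pos edge_subset[OF f] by (intro prod_nonneg) (auto intro: less_imp_le)
      have "(\<Sum>z\<in>f. x z ^ k) = x w ^ k + (\<Sum>z\<in>f - {w}. x z ^ k)"
        "(\<Prod>z\<in>f. x z) = x w * (\<Prod>z\<in>f - {w}. x z)"
        using uw finite_edge[OF f] by (auto intro: sum.remove prod.remove)
      moreover have "(\<Sum>z\<in>?m f. x z ^ k) = x u ^ k + (\<Sum>z\<in>f - {w}. x z ^ k)"
        "(\<Prod>z\<in>?m f. x z) = x u * (\<Prod>z\<in>f - {w}. x z)"
        using True fin by (simp_all add: move_edge_def)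
      moreover have "x w * (\<Prod>z\<in>f - {w}. x z) \<le> x u * (\<Prod>z\<in>f - {w}. x z)"
        using le nn by (rule mult_right_mono)
      ultimately show ?thesis
        using pow \<alpha> by (intro add_mono mult_left_mono) simp_all
    qed (simp add: move_edge_def)
  qed
  then have form_le: "edge_form k \<alpha> E x \<le> edge_form k \<alpha> (?m ` E) x"
    unfolding edge_form_def by (simp add: sum.reindex[OF inj_on_move_edge] o_def)
  let ?h = "\<lambda>e. of_real \<alpha> * x u ^ (k - 1) + of_real (1 - \<alpha>) * (\<Prod>z\<in>e - {u}. x z)"
  have hpos: "0 < ?h e" if "e \<subseteq> V" for e
  proof -
    have "0 < (\<Prod>z\<in>e - {u}. x z)" using pos that by (intro prod_pos) auto
    moreover have "0 \<le> \<alpha> * x u ^ (k - 1)" using \<alpha> pos[OF u] by simp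
    ultimately show ?thesis using \<alpha> by (simp add: add_nonneg_pos)
  qed
  have op_less: "edge_operator k \<alpha> E x u < edge_operator k \<alpha> (?m ` E) x u"
    unfolding edge_operator_def
  proof (rule sum_strict_mono2)
    show "finite {e \<in> ?m ` E. u \<in> e}" using finite_edges by simp
    have keep: "?m e = e" if "u \<in> e" for e using that M[of e] by (auto simp: move_edge_def)
    show "{e \<in> E. u \<in> e} \<subseteq> {e \<in> ?m ` E. u \<in> e}"
      using keep by (metis (no_types, lifting) Collect_mono image_eqI)
    have uf: "u \<in> ?m f0" using f0 by (simp add: move_edge_def)
    have f0E: "f0 \<in> E" "u \<notin> f0" using M[OF f0] by auto
    \<comment> \<open>The image contains \<open>u\<close>, so as an edge of \<open>E\<close> it
      would be fixed by the move; injectivity would then identify it with \<open>f0\<close>, which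
      avoids \<open>u\<close>.\<close>
    have "?m f0 \<notin> E"
    proof
      assume "?m f0 \<in> E"
      then have "?m f0 = f0"
        using inj_onD[OF inj_on_move_edge keep[OF uf]] f0E(1) by blast
      then show False using uf f0E by simp
    qed
    then show "?m f0 \<in> {e \<in> ?m ` E. u \<in> e} - {e \<in> E. u \<in> e}" using uf f0E by simp
    then show "0 < ?h (?m f0)" using hpos E'.edge_subset by blast
    show "0 \<le> ?h e" if "e \<in> {e \<in> ?m ` E. u \<in> e}" for e
      using hpos[of e] E'.edge_subset[of e] that by simp
  qed
  show ?thesis
    using x unfolding perron_def
    by (intro rho_less[OF uniform_edges_axioms uniform_move_edge \<alpha> _ _ _ form_le u op_less]) auto
qed

lemma deg2_move_edge:
  assumes "deg2 E z" "z \<noteq> w"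
  shows "deg2 (move_edge u w M ` E) z"
proof -
  obtain f g where fg: "f \<in> E" "g \<in> E" "f \<noteq> g" "z \<in> f" "z \<in> g" using assms(1) unfolding deg2_def by blast
  have "move_edge u w M f \<noteq> move_edge u w M g"
    using inj_onD[OF inj_on_move_edge] fg by blast
  then show ?thesis using fg assms(2) by (intro deg2I[of "move_edge u w M f" _ "move_edge u w M g"])
      (auto simp: move_edge_def)
qed

end

section \<open>Contraction of an edge at two of its vertices\<close>

abbreviation contraction :: "'a set \<Rightarrow> 'a \<Rightarrow> 'a \<Rightarrow> 'a set \<Rightarrow> 'a set" where
  "contraction e u w \<equiv> move_edge u w {f \<in> E. w \<in> f \<and> f \<noteq> e}"

context
  fixes e u w
  assumes e: "e \<in> E" "u \<in> e" "w \<in> e" "u \<noteq> w"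
begin

lemma contraction_moves:
  "f \<in> {f \<in> E. w \<in> f \<and> f \<noteq> e} \<Longrightarrow> f \<in> E \<and> w \<in> f \<and> u \<notin> f"
  using linear[of e f u w] e by auto

lemma u_in_V: "u \<in> V"
  using e edge_subset by blast

lemma contraction_inj: "f \<in> E \<Longrightarrow> g \<in> E \<Longrightarrow> f \<noteq> g \<Longrightarrow> contraction e u w f \<noteq> contraction e u w g"
  using inj_onD[OF inj_on_move_edge[OF contraction_moves u_in_V]] by blast

lemma contraction_self: "contraction e u w e = e"
  by (simp add: move_edge_def)

lemma card_image_contraction: "card (contraction e u w ` E) = card E"
  using inj_on_move_edge[OF contraction_moves u_in_V] by (rule card_image)

text \<open>The edge \<open>e\<close> stays in place and holds both \<open>u\<close> and
  \<open>w\<close>, so a set closed under the new edges contains both or neither; exchanging them in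
  other edges then does not affect closedness.\<close>

lemma hypertree_contraction: "hypertree k V (contraction e u w ` E)"
proof (rule hypertree_move_edge[OF contraction_moves u_in_V])
  show "hconn V (contraction e u w ` E)"
    unfolding hconn_def
  proof (intro allI impI)
    fix S assume S: "S \<subseteq> V" "S \<noteq> {} \<and> (\<forall>g\<in>contraction e u w ` E. g \<inter> S \<noteq> {} \<longrightarrow> g \<subseteq> S)"
    then have closed: "contraction e u w f \<subseteq> S" if "f \<in> E" "contraction e u w f \<inter> S \<noteq> {}" for f
      using that by blast
    have uw: "u \<in> S \<longleftrightarrow> w \<in> S"
      using closed[OF e(1)] e unfolding contraction_self by blast
    show "S = V"
    proof (rule hconnD[OF conn S(1)])
      fix f assume f: "f \<in> E" "f \<inter> S \<noteq> {}"
      show "f \<subseteq> S"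
      proof (cases "w \<in> f \<and> f \<noteq> e")
        case True
        then have m: "contraction e u w f = insert u (f - {w})" using f by (simp add: move_edge_def)
        then show ?thesis using closed[OF f(1)] f(2) uw by blast
      next
        case False
        then have "contraction e u w f = f" by (auto simp: move_edge_def)
        then show ?thesis using closed[OF f(1)] f(2) by simp
      qed
    qed (use S in blast)
  qed
qed

lemma self_in_contraction: "e \<in> contraction e u w ` E"
  using imageI[OF e(1), of "contraction e u w"] unfolding contraction_self .

lemma deg2_contraction:
  assumes "deg2 E z" "z \<noteq> w"
  shows "deg2 (contraction e u w ` E) z"
proof (rule deg2_move_edge[where M = "{f \<in> E. w \<in> f \<and> f \<noteq> e}"])
  show "\<And>f. f \<in> {f \<in> E. w \<in> f \<and> f \<noteq> e} \<Longrightarrow> f \<in> E \<and> w \<in> f \<and> u \<notin> f" by (rule contraction_moves)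
qed (use u_in_V assms in simp_all)

lemma deg2_contraction_target:
  assumes "deg2 E w"
  shows "deg2 (contraction e u w ` E) u"
proof -
  obtain f where f: "f \<in> E" "f \<noteq> e" "w \<in> f" using assms unfolding deg2_def by metis
  have "u \<in> contraction e u w f" using f by (simp add: move_edge_def)
  moreover have "contraction e u w e = e" by (rule contraction_self)
  moreover have "contraction e u w f \<noteq> contraction e u w e" using contraction_inj f e by blast
  ultimately show ?thesis using f e
    by (intro deg2I[of "contraction e u w f" _ e]) (simp_all add: self_in_contraction)
qed

text \<open>If \<open>w\<close> is one of the two branching vertices of \<open>f\<close>, then
  \<open>u\<close> takes over its role; it differs from the other one because \<open>f\<close>
  cannot contain both \<open>u\<close> and \<open>w\<close>.\<close>

lemma nonpendant_contraction:
  assumes f: "f \<in> E" "f \<noteq> e" "nonpendant E f"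
  shows "nonpendant (contraction e u w ` E) (contraction e u w f)"
proof -
  obtain a b where ab: "a \<in> f" "b \<in> f" "a \<noteq> b" "deg2 E a" "deg2 E b" "b \<noteq> w"
    using f(3) unfolding nonpendant_def by metis
  have b: "b \<in> contraction e u w f" "deg2 (contraction e u w ` E) b"
    using ab by (simp_all add: move_edge_def[of u w _ f] deg2_contraction)
  show ?thesis
  proof (cases "a = w")
    case True
    then have fM: "f \<in> {f \<in> E. w \<in> f \<and> f \<noteq> e}" using f ab by simp
    then have "u \<in> contraction e u w f" "u \<noteq> b"
      using contraction_moves[OF fM] ab by (auto simp: move_edge_def)
    then show ?thesis using b deg2_contraction_target True ab by (intro nonpendantI[of u _ b]) auto
  next
    case False
    then have "a \<in> contraction e u w f" "deg2 (contraction e u w ` E) a"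
      using ab by (simp_all add: move_edge_def[of u w _ f] deg2_contraction)
    then show ?thesis using b ab by (intro nonpendantI[of a _ b])
  qed
qed

text \<open>Contraction turns \<open>w\<close> into a vertex of \<open>e\<close> alone, so
  \<open>e\<close> relies on a third branching vertex \<open>z\<close> besides
  \<open>u\<close>.\<close>

lemma nonpendant_contraction_self:
  assumes "z \<in> e" "z \<noteq> u" "z \<noteq> w" "deg2 E z" "deg2 E w"
  shows "nonpendant (contraction e u w ` E) e"
proof (rule nonpendantI)
  show "deg2 (contraction e u w ` E) u" using assms(5) by (rule deg2_contraction_target)
  show "deg2 (contraction e u w ` E) z" using assms(4,3) by (rule deg2_contraction)
qed (use assms e in simp_all)

lemma rho_contraction:
  assumes "0 \<le> \<alpha>" "\<alpha> < 1" "perron k \<alpha> V E x" "x w \<le> x u" "deg2 E w"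
  shows "rho k \<alpha> (Hypergraph V E) < rho k \<alpha> (Hypergraph V (contraction e u w ` E))"
proof (rule rho_move_edge[OF contraction_moves u_in_V assms(1-4)])
  show "{f \<in> E. w \<in> f \<and> f \<noteq> e} \<noteq> {}" using assms(5) unfolding deg2_def by blast
qed

end

text \<open>Unlike in a contraction, \<open>u\<close> and \<open>w\<close> need not be adjacent.\<close>

lemma hypertree_move_pendant:
  assumes f: "f \<in> E" "w \<in> f" "u \<notin> f" "u \<in> V" and pend: "\<And>z. z \<in> f \<Longrightarrow> z \<noteq> w \<Longrightarrow> \<not> deg2 E z"
  shows "hypertree k V (move_edge u w {f} ` E)"
proof (rule hypertree_move_edge)
  show "hconn V (move_edge u w {f} ` E)"
    unfolding hconn_def
  proof (intro allI impI)
    fix S assume S: "S \<subseteq> V" "S \<noteq> {} \<and> (\<forall>g\<in>move_edge u w {f} ` E. g \<inter> S \<noteq> {} \<longrightarrow> g \<subseteq> S)"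
    have closed_f: "insert u (f - {w}) \<subseteq> S" if "insert u (f - {w}) \<inter> S \<noteq> {}"
    proof -
      have "move_edge u w {f} f = insert u (f - {w})" by (simp add: move_edge_def)
      then have "insert u (f - {w}) \<in> move_edge u w {f} ` E" using f(1) by (metis imageI)
      then show ?thesis using S that by blast
    qed
    have closed: "g \<subseteq> S" if "g \<in> E" "g \<noteq> f" "g \<inter> S \<noteq> {}" for g
    proof -
      have "move_edge u w {f} g = g" using that by (simp add: move_edge_def)
      then have "g \<in> move_edge u w {f} ` E" using that(1) by (metis imageI)
      then show ?thesis using S that by blast
    qed
    \<comment> \<open>The set \<open>S\<close> with the pendant edge put back: \<open>f\<close>
      follows \<open>w\<close> instead of \<open>u\<close>. It is closed under the old edges, so
      connectivity of \<open>E\<close> applies to it.\<close>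
    define S' where "S' = (S - f) \<union> (if w \<in> S then f else {})"
    have wS: "w \<in> S' \<longleftrightarrow> w \<in> S" unfolding S'_def using f by auto
    have "S' = V"
    proof (rule hconnD[OF conn])
      show "S' \<subseteq> V" unfolding S'_def using S(1) edge_subset[OF f(1)] by auto
      show "S' \<noteq> {}"
      proof
        assume empty: "S' = {}"
        obtain s where s: "s \<in> S" using S by blast
        then have "s \<in> f" "w \<notin> S" using empty wS unfolding S'_def by auto
        then have "insert u (f - {w}) \<inter> S \<noteq> {}" using s by auto
        then have "u \<in> S" using closed_f by blast
        then have "u \<in> S'" unfolding S'_def using f by simp
        then show False using empty by simp
      qed
      fix h assume h: "h \<in> E" "h \<inter> S' \<noteq> {}"
      show "h \<subseteq> S'"
      proof (cases "h = f")
        case True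
        then have "w \<in> S" using h(2) unfolding S'_def by (auto split: if_splits)
        then show ?thesis unfolding S'_def using True by simp
      next
        case False
        have hf: "z = w" if "z \<in> h" "z \<in> f" for z
          using pend[OF that(2)] deg2I[OF h(1) f(1) False that] by blast
        then have "h \<inter> S \<noteq> {}" using h(2) unfolding S'_def by (auto split: if_splits)
        then have "h \<subseteq> S" using closed h(1) False by blast
        then show ?thesis using hf unfolding S'_def by auto
      qed
    qed
    moreover have "w \<in> V" using f edge_subset by blast
    ultimately have "w \<in> S" "u \<in> S" using wS f unfolding S'_def by (auto split: if_splits)
    then have "f \<subseteq> S" using closed_f by blast
    then show "S = V" using \<open>S' = V\<close> S(1) unfolding S'_def by (auto split: if_splits)
  qed
qed (use f in auto)

end

section \<open>Extremal non-caterpillars\<close>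

text \<open>Only competitors with a branch vertex are compared, because every modification below
  creates or preserves one; \<open>E\<close> itself may at first have a branch edge only.\<close>

locale extremal = hypertree +
  fixes \<alpha> :: real
  assumes alpha: "0 \<le> \<alpha>" "\<alpha> < 1"
    and maximal: "\<And>E'. hypertree k V E' \<Longrightarrow> card E' = card E \<Longrightarrow> branch_vertex E' \<Longrightarrow>
      rho k \<alpha> (Hypergraph V E') \<le> rho k \<alpha> (Hypergraph V E)"
begin

text \<open>The two contractions are isomorphic; the one towards the larger Perron entry increases \<open>rho\<close>.\<close>

lemma no_branching_contraction:
  assumes "e \<in> E" "a \<in> e" "b \<in> e" "a \<noteq> b" "deg2 E a" "deg2 E b"
    and "branch_vertex (contraction e a b ` E)" "branch_vertex (contraction e b a ` E)"
  shows False
proof -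
  obtain x where x: "perron k \<alpha> V E x" using ex_perron[OF alpha] by blast
  have "\<not> x b \<le> x a" if "e \<in> E" "a \<in> e" "b \<in> e" "a \<noteq> b" "deg2 E b"
    "branch_vertex (contraction e a b ` E)" for a b
    using rho_contraction[OF that(1-4) alpha x _ that(5)]
      maximal[OF hypertree_contraction[OF that(1-4)] card_image_contraction[OF that(1-4)] that(6)]
    by linarith
  then have "\<not> x b \<le> x a" "\<not> x a \<le> x b" using assms by simp_all
  then show False by linarith
qed

text \<open>Contracting \<open>e\<close> at \<open>v1\<close> and \<open>v2\<close> brings
  \<open>f1\<close>, \<open>f2\<close> and \<open>e\<close> together at one vertex, while
  \<open>v3\<close> keeps \<open>e\<close> non-pendant. The result has a branch vertex in either
  direction.\<close>

lemma not_branch_edge: "\<not> branch_edge E"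
proof
  assume "branch_edge E"
  then obtain e v1 v2 v3 f1 f2 f3 where A: "{e, f1, f2, f3} \<subseteq> E" "e \<notin> {f1, f2, f3}"
    "distinct [v1, v2, v3]" "{v1, v2, v3} \<subseteq> e" "v1 \<in> f1" "v2 \<in> f2" "v3 \<in> f3"
    "nonpendant E f1" "nonpendant E f2"
    unfolding branch_edge_def by (elim exE conjE)
  have d3: "deg2 E v3" using A by (intro deg2I[of e _ f3]) auto
  have merged: "branch_vertex (contraction e a b ` E)"
    if "a \<in> e" "b \<in> e" "a \<noteq> b" "v3 \<noteq> a" "v3 \<noteq> b" "f \<in> E" "g \<in> E" "f \<noteq> e" "g \<noteq> e" "a \<in> f" "b \<in> g"
      "nonpendant E f" "nonpendant E g" for a b f g
  proof -
    have e: "e \<in> E" using A by simp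
    note E = e that(1-3)
    have "f \<noteq> g" using linear[of f e a b] that e by blast
    have db: "deg2 E b" using that e by (intro deg2I[of e _ g]) auto
    show ?thesis
    proof (rule branch_vertexI[of "contraction e a b f" _ "contraction e a b g" e a])
      show "contraction e a b f \<in> contraction e a b ` E" "contraction e a b g \<in> contraction e a b ` E"
        "e \<in> contraction e a b ` E"
        using that self_in_contraction[OF E] by simp_all
      show "contraction e a b f \<noteq> contraction e a b g"
        using contraction_inj[OF E] that \<open>f \<noteq> g\<close> by blast
      show "contraction e a b f \<noteq> e" "contraction e a b g \<noteq> e"
        using contraction_inj[OF E that(6) e that(8)] contraction_inj[OF E that(7) e that(9)]
        unfolding contraction_self[OF E] by simp_all
      show "a \<in> contraction e a b f" "a \<in> contraction e a b g"
        using that by (simp_all add: move_edge_def)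
      show "nonpendant (contraction e a b ` E) e"
        using A(4) that db d3 by (intro nonpendant_contraction_self[OF E, of v3]) auto
    qed (use that nonpendant_contraction[OF E] in simp_all)
  qed
  show False
  proof (rule no_branching_contraction[of e v1 v2])
    show "deg2 E v1" using A by (intro deg2I[of e _ f1]) auto
    show "deg2 E v2" using A by (intro deg2I[of e _ f2]) auto
    show "branch_vertex (contraction e v1 v2 ` E)" using A by (intro merged[of v1 v2 f1 f2]) auto
    show "branch_vertex (contraction e v2 v1 ` E)" using A by (intro merged[of v2 v1 f2 f1]) auto
  qed (use A in auto)
qed

text \<open>Two contractions are excluded. A fourth non-pendant edge could be contracted, since the
  three edges at the branch vertex survive. So could one of these three at two branching vertices
  other than \<open>v\<close>, since \<open>v\<close> and the merged vertex keep it
  non-pendant.\<close>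

lemma tripod_structure:
  assumes "branch_vertex E"
  shows "\<exists>v u. card {f \<in> E. nonpendant E f} = 3 \<and>
    (\<forall>t\<in>{f \<in> E. nonpendant E f}. v \<in> t \<and> u t \<in> t \<and> u t \<noteq> v \<and> deg2 E (u t) \<and>
      (\<forall>z\<in>t. deg2 E z \<longrightarrow> z = v \<or> z = u t))"
proof -
  let ?T = "{f \<in> E. nonpendant E f}"
  obtain v e1 e2 e3 where B: "e1 \<in> E" "e2 \<in> E" "e3 \<in> E" "e1 \<noteq> e2" "e1 \<noteq> e3" "e2 \<noteq> e3"
    "v \<in> e1" "v \<in> e2" "v \<in> e3" "nonpendant E e1" "nonpendant E e2" "nonpendant E e3"
    using assms unfolding branch_vertex_def by auto
  have T: "?T = {e1, e2, e3}"
  proof (rule ccontr)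
    assume "?T \<noteq> {e1, e2, e3}"
    then obtain f where f: "f \<in> E" "nonpendant E f" "f \<noteq> e1" "f \<noteq> e2" "f \<noteq> e3" using B by blast
    then obtain a b where ab: "a \<in> f" "b \<in> f" "a \<noteq> b" "deg2 E a" "deg2 E b"
      unfolding nonpendant_def by blast
    have merged: "branch_vertex (contraction f a b ` E)"
      if "a \<in> f" "b \<in> f" "a \<noteq> b" for a b
    proof -
      note E = f(1) that
      let ?c = "contraction f a b"
      show ?thesis
      \<comment> \<open>If \<open>v\<close> is the vertex emptied by the contraction, its three
        edges reappear at \<open>a\<close>.\<close>
      proof (rule branch_vertexI[of "?c e1" _ "?c e2" "?c e3" "if v = b then a else v"])
        show "?c e1 \<noteq> ?c e2" "?c e1 \<noteq> ?c e3" "?c e2 \<noteq> ?c e3"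
          using contraction_inj[OF E] B by blast+
        show "(if v = b then a else v) \<in> ?c e1" "(if v = b then a else v) \<in> ?c e2"
          "(if v = b then a else v) \<in> ?c e3"
          using B f by (auto simp: move_edge_def)
      qed (use B f nonpendant_contraction[OF E] in simp_all)
    qed
    show False
      using no_branching_contraction[OF f(1) ab merged[OF ab(1-3)] merged[OF ab(2,1) ab(3)[symmetric]]] .
  qed
  have dv: "deg2 E v" using B by (intro deg2I[of e1 _ e2])
  have two: "a = b" if t: "t \<in> {e1, e2, e3}" and ab: "a \<in> t" "b \<in> t" "a \<noteq> v" "b \<noteq> v" "deg2 E a" "deg2 E b" for t a b
  proof (rule ccontr)
    assume "a \<noteq> b"
    obtain f g where fg: "{t, f, g} = {e1, e2, e3}" "t \<noteq> f" "t \<noteq> g" "f \<noteq> g"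
      using t B by blast
    have tfg: "t \<in> E" "f \<in> E" "g \<in> E" "v \<in> t" "v \<in> f" "v \<in> g" "nonpendant E f" "nonpendant E g"
    proof -
      have "\<forall>h\<in>{t, f, g}. h \<in> E \<and> v \<in> h \<and> nonpendant E h" unfolding fg(1) using B by simp
      then show "t \<in> E" "f \<in> E" "g \<in> E" "v \<in> t" "v \<in> f" "v \<in> g" "nonpendant E f" "nonpendant E g"
        by simp_all
    qed
    have merged: "branch_vertex (contraction t a b ` E)"
      if "a \<in> t" "b \<in> t" "a \<noteq> b" "v \<noteq> a" "v \<noteq> b" "deg2 E b" for a b
    proof -
      note E = tfg(1) that(1-3)
      let ?c = "contraction t a b"
      show ?thesis
      proof (rule branch_vertexI[of t _ "?c f" "?c g" v])
        show "t \<in> ?c ` E" by (rule self_in_contraction[OF E])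
        show "t \<noteq> ?c f" "t \<noteq> ?c g" "?c f \<noteq> ?c g"
          using contraction_inj[OF E tfg(1,2) fg(2)] contraction_inj[OF E tfg(1,3) fg(3)]
            contraction_inj[OF E tfg(2,3) fg(4)] unfolding contraction_self[OF E] by simp_all
        show "v \<in> ?c f" "v \<in> ?c g" using tfg that by (simp_all add: move_edge_def)
        show "nonpendant (?c ` E) t"
          using tfg that dv by (intro nonpendant_contraction_self[OF E, of v]) auto
      qed (use tfg fg nonpendant_contraction[OF E] in simp_all)
    qed
    have "branch_vertex (contraction t a b ` E)" using ab \<open>a \<noteq> b\<close> by (intro merged) simp_all
    moreover have "branch_vertex (contraction t b a ` E)" using ab \<open>a \<noteq> b\<close> by (intro merged) simp_all
    ultimately show False
      using no_branching_contraction[OF tfg(1) ab(1,2) \<open>a \<noteq> b\<close> ab(5,6)] by blast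
  qed
  have ex: "\<exists>a. a \<in> t \<and> a \<noteq> v \<and> deg2 E a" if "t \<in> ?T" for t
    using that unfolding nonpendant_def by blast
  define u where "u t = (SOME a. a \<in> t \<and> a \<noteq> v \<and> deg2 E a)" for t
  have u: "u t \<in> t \<and> u t \<noteq> v \<and> deg2 E (u t)" if "t \<in> ?T" for t
    unfolding u_def using ex[OF that] by (rule someI_ex)
  have "card ?T = 3" unfolding T using B by simp
  moreover have "v \<in> t \<and> u t \<in> t \<and> u t \<noteq> v \<and> deg2 E (u t) \<and> (\<forall>z\<in>t. deg2 E z \<longrightarrow> z = v \<or> z = u t)"
    if t: "t \<in> ?T" for t
  proof -
    have "t \<in> {e1, e2, e3}" using t T by blast
    moreover from this have "v \<in> t" using B by blast
    ultimately show ?thesis using u[OF t] two[of t _ "u t"] by blast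
  qed
  ultimately show ?thesis by blast
qed

end

text \<open>\<open>T\<close> is the set of the three non-pendant edges; \<open>u t\<close> is the second branching vertex of \<open>t\<close>.\<close>

locale tripod = hypertree +
  fixes T :: "'a set set" and v :: 'a and u :: "'a set \<Rightarrow> 'a"
  assumes T_def: "T = {f \<in> E. nonpendant E f}" and card_T: "card T = 3"
    and T_ends: "t \<in> T \<Longrightarrow> v \<in> t" "t \<in> T \<Longrightarrow> u t \<in> t" "t \<in> T \<Longrightarrow> u t \<noteq> v" "t \<in> T \<Longrightarrow> deg2 E (u t)"
    and T_deg2: "t \<in> T \<Longrightarrow> z \<in> t \<Longrightarrow> deg2 E z \<Longrightarrow> z = v \<or> z = u t"
begin

section \<open>Distribution of the pendant edges of a tripod\<close>

definition pendants :: "'a \<Rightarrow> 'a set set" where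
  "pendants z = {f \<in> E - T. z \<in> f}"

lemma T_sub: "T \<subseteq> E"
  unfolding T_def by blast

lemma finite_T: "finite T"
  using T_sub finite_edges finite_subset by blast

lemma T_ex: "\<exists>t1 t2 t3. T = {t1, t2, t3} \<and> t1 \<noteq> t2 \<and> t1 \<noteq> t3 \<and> t2 \<noteq> t3"
  using card_T card_3_iff[of T] by blast

lemma deg2_v: "deg2 E v"
proof -
  obtain t1 t2 t3 where t: "T = {t1, t2, t3}" "t1 \<noteq> t2" using T_ex by blast
  then have "t1 \<in> T" "t2 \<in> T" by simp_all
  then show ?thesis using T_sub T_ends(1) t by (intro deg2I[of t1 _ t2]) auto
qed

lemma u_inj: "t \<in> T \<Longrightarrow> t' \<in> T \<Longrightarrow> u t = u t' \<Longrightarrow> t = t'"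
  using linear[of t t' "u t" v] T_ends T_sub by (metis subsetD)

lemma pendant_deg2_unique:
  assumes "f \<in> E - T" "a \<in> f" "b \<in> f" "deg2 E a" "deg2 E b"
  shows "a = b"
  using assms unfolding T_def nonpendant_def by blast

text \<open>If \<open>z\<close> lies in no edge of \<open>T\<close>, all edges at \<open>z\<close>
  are pendant with \<open>z\<close> as sole branching vertex. Their union is then closed and equals
  \<open>V\<close>, so one of them contains \<open>v\<close>, which forces
  \<open>z = v\<close>.\<close>

lemma deg2_cases:
  assumes z: "deg2 E z"
  shows "z = v \<or> (\<exists>t\<in>T. z = u t)"
proof (cases "\<exists>t\<in>T. z \<in> t")
  case True
  then show ?thesis using T_deg2 z by blast
next
  case False
  define S where "S = \<Union>{f \<in> E. z \<in> f}"
  have "S = V"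
  proof (rule hconnD[OF conn])
    show "S \<subseteq> V" unfolding S_def using edge_subset by blast
    show "S \<noteq> {}" using z unfolding S_def deg2_def by blast
    fix h assume h: "h \<in> E" "h \<inter> S \<noteq> {}"
    then obtain y f where f: "f \<in> E" "z \<in> f" "y \<in> f" "y \<in> h" unfolding S_def by blast
    have "z \<in> h"
    proof (rule ccontr)
      assume "z \<notin> h"
      then have "deg2 E y" using f h by (intro deg2I[of f _ h]) auto
      moreover have "f \<in> E - T" using f False by blast
      ultimately have "y = z" using pendant_deg2_unique f z by blast
      then show False using f \<open>z \<notin> h\<close> by simp
    qed
    then show "h \<subseteq> S" unfolding S_def using h by blast
  qed
  moreover obtain t where t: "t \<in> T" using T_ex by blast
  ultimately have "v \<in> S" using T_ends(1)[OF t] T_sub edge_subset by blast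
  then obtain f where f: "f \<in> E" "z \<in> f" "v \<in> f" unfolding S_def by blast
  then have "f \<in> E - T" using False by blast
  then show ?thesis using pendant_deg2_unique f z deg2_v by blast
qed

lemma pendant_has_deg2:
  assumes f: "f \<in> E - T"
  shows "\<exists>z\<in>f. deg2 E z"
proof (rule ccontr)
  assume no: "\<not> ?thesis"
  have "f = V"
  proof (rule hconnD[OF conn])
    fix h assume h: "h \<in> E" "h \<inter> f \<noteq> {}"
    then obtain y where "y \<in> h" "y \<in> f" by blast
    then have "h = f" using no deg2I[of h E f y] h f by blast
    then show "h \<subseteq> f" by simp
  qed (use f edge_subset edge_nonempty in auto)
  moreover obtain t where t: "t \<in> T" using T_ex by blast
  then have "v \<in> V" using T_ends(1) T_sub edge_subset by blast
  ultimately show False using no deg2_v by blast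
qed

text \<open>This is the forced pendant edge: a second edge of \<open>T\<close> through
  \<open>u t\<close> would share both \<open>v\<close> and \<open>u t\<close> with
  \<open>t\<close>.\<close>

lemma pendants_u_nonempty:
  assumes t: "t \<in> T"
  shows "pendants (u t) \<noteq> {}"
proof -
  obtain f where f: "f \<in> E" "f \<noteq> t" "u t \<in> f"
    using T_ends(4)[OF t] unfolding deg2_def by metis
  have "f \<notin> T"
  proof
    assume "f \<in> T"
    then have "u f = u t" using T_deg2[OF \<open>f \<in> T\<close> f(3)] T_ends[OF t] by auto
    then show False using u_inj[OF \<open>f \<in> T\<close> t] f by simp
  qed
  then show ?thesis using f unfolding pendants_def by blast
qed

text \<open>The 3 counts the edges of \<open>T\<close>; each other edge contains exactly one
  branching vertex, which is \<open>v\<close> or some \<open>u t\<close>.\<close>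

lemma card_E: "card E = 3 + card (pendants v) + (\<Sum>t\<in>T. card (pendants (u t)))"
proof -
  have fin: "finite (pendants z)" for z using finite_edges unfolding pendants_def by simp
  have eq: "E - T = pendants v \<union> (\<Union>t\<in>T. pendants (u t))"
  proof (intro set_eqI iffI)
    fix f assume f: "f \<in> E - T"
    then obtain z where "z \<in> f" "deg2 E z" using pendant_has_deg2 by blast
    then show "f \<in> pendants v \<union> (\<Union>t\<in>T. pendants (u t))"
      using f deg2_cases[of z] unfolding pendants_def by blast
  qed (auto simp: pendants_def)
  have disj: "pendants a \<inter> pendants b = {}" if "deg2 E a" "deg2 E b" "a \<noteq> b" for a b
    using that pendant_deg2_unique unfolding pendants_def by blast
  have "card (\<Union>t\<in>T. pendants (u t)) = (\<Sum>t\<in>T. card (pendants (u t)))"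
  proof (rule card_UN_disjoint[OF finite_T])
    show "\<forall>i\<in>T. \<forall>j\<in>T. i \<noteq> j \<longrightarrow> pendants (u i) \<inter> pendants (u j) = {}"
      using disj T_ends(4) u_inj by blast
  qed (use fin in blast)
  moreover have "pendants v \<inter> (\<Union>t\<in>T. pendants (u t)) = {}"
    using disj[OF deg2_v] T_ends(3,4) by blast
  ultimately have "card (E - T) = card (pendants v) + (\<Sum>t\<in>T. card (pendants (u t)))"
    unfolding eq using fin finite_T by (subst card_Un_disjoint) auto
  moreover have "card E = card T + card (E - T)"
    using T_sub finite_edges card_mono[OF finite_edges T_sub] finite_T by (simp add: card_Diff_subset)
  ultimately show ?thesis using card_T by simp
qed

text \<open>Only \<open>w\<close> can lose degree. The edges of \<open>T\<close> alone keep
  \<open>v\<close> branching, and if \<open>w\<close> is some \<open>u t\<close>, the remaining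
  pendant edge together with \<open>t\<close> does so for \<open>w\<close>.\<close>

lemma branch_vertex_move_pendant:
  assumes f: "f \<in> pendants w" and spare: "w = v \<or> (\<exists>g\<in>pendants w. g \<noteq> f)"
    and a: "a \<in> V" "a \<notin> f"
  shows "branch_vertex (move_edge a w {f} ` E)"
proof -
  let ?m = "move_edge a w {f}"
  have fE: "f \<in> E" "f \<notin> T" "w \<in> f" using f unfolding pendants_def by auto
  have keep: "g \<in> ?m ` E" if "g \<in> E" "g \<noteq> f" for g
    using that by (intro image_eqI[of _ _ g]) (simp_all add: move_edge_def)
  have tE: "t \<in> ?m ` E" if "t \<in> T" for t using keep T_sub that fE by blast
  have deg: "deg2 (?m ` E) z" if "deg2 E z" "z \<noteq> w" for z
    using a fE that by (intro deg2_move_edge[where M = "{f}"]) auto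
  obtain t1 t2 t3 where t: "T = {t1, t2, t3}" "t1 \<noteq> t2" "t1 \<noteq> t3" "t2 \<noteq> t3" using T_ex by blast
  then have tT: "t1 \<in> T" "t2 \<in> T" "t3 \<in> T" by simp_all
  have degv: "deg2 (?m ` E) v"
    using tE tT t T_ends(1) by (intro deg2I[of t1 _ t2]) auto
  have np: "nonpendant (?m ` E) t" if tt: "t \<in> T" for t
  proof -
    have "deg2 (?m ` E) (u t)"
    proof (cases "u t = w")
      case True
      then obtain g where "g \<in> pendants w" "g \<noteq> f" using spare T_ends(3)[OF tt] by blast
      then have g: "g \<in> E" "g \<notin> T" "w \<in> g" "g \<noteq> f" unfolding pendants_def by auto
      then have "t \<noteq> g" using tt by blast
      moreover have "g \<in> ?m ` E" using keep g by blast
      ultimately show ?thesis using tE[OF tt] T_ends(2)[OF tt] g(3) True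
        by (intro deg2I[of t _ g]) simp_all
    qed (use deg T_ends(4)[OF tt] in blast)
    then show ?thesis using degv T_ends[OF tt] by (intro nonpendantI[of "u t" _ v]) auto
  qed
  show ?thesis
    using t tE[OF tT(1)] tE[OF tT(2)] tE[OF tT(3)] np[OF tT(1)] np[OF tT(2)] np[OF tT(3)]
      T_ends(1)[OF tT(1)] T_ends(1)[OF tT(2)] T_ends(1)[OF tT(3)]
    by (intro branch_vertexI[of t1 _ t2 t3 v])
qed

end

locale extremal_tripod = extremal + tripod
begin

text \<open>Of two vertices that can each give up a pendant edge, the one with the smaller Perron
  entry would pass it to the other and increase the radius. The two possible results need not be
  isomorphic, but both have a branch vertex.\<close>

lemma spare_unique:
  assumes "deg2 E a" "deg2 E b" "f \<in> pendants a" "g \<in> pendants b"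
    and "a = v \<or> (\<exists>f'\<in>pendants a. f' \<noteq> f)" "b = v \<or> (\<exists>g'\<in>pendants b. g' \<noteq> g)"
  shows "a = b"
proof (rule ccontr)
  assume "a \<noteq> b"
  obtain x where x: "perron k \<alpha> V E x" using ex_perron[OF alpha] by blast
  have "\<not> x w \<le> x z" if w: "deg2 E w" and z: "deg2 E z" and f: "f \<in> pendants w"
    and sp: "w = v \<or> (\<exists>g\<in>pendants w. g \<noteq> f)" and "w \<noteq> z" for w z f
  proof
    assume le: "x w \<le> x z"
    have fE: "f \<in> E" "f \<in> E - T" "w \<in> f" using f unfolding pendants_def by auto
    have zf: "z \<notin> f" using pendant_deg2_unique[OF fE(2,3) _ w z] \<open>w \<noteq> z\<close> by blast
    have zV: "z \<in> V" using z edge_subset unfolding deg2_def by blast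
    have M: "\<And>h. h \<in> {f} \<Longrightarrow> h \<in> E \<and> w \<in> h \<and> z \<notin> h" using fE zf by blast
    have "hypertree k V (move_edge z w {f} ` E)"
      using fE zf zV pendant_deg2_unique[OF fE(2,3) _ w] by (intro hypertree_move_pendant) auto
    moreover have "card (move_edge z w {f} ` E) = card E"
      using inj_on_move_edge[OF M zV] by (rule card_image)
    moreover have "branch_vertex (move_edge z w {f} ` E)"
      using branch_vertex_move_pendant[OF f sp zV zf] .
    ultimately have "rho k \<alpha> (Hypergraph V (move_edge z w {f} ` E)) \<le> rho k \<alpha> (Hypergraph V E)"
      by (rule maximal)
    moreover have "rho k \<alpha> (Hypergraph V E) < rho k \<alpha> (Hypergraph V (move_edge z w {f} ` E))"
      using M zV alpha x le by (rule rho_move_edge) simp_all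
    ultimately show False by simp
  qed
  from this[OF assms(1,2,3,5) \<open>a \<noteq> b\<close>] this[OF assms(2,1,4,6) \<open>a \<noteq> b\<close>[symmetric]]
  show False by linarith
qed

text \<open>By \<open>spare_unique\<close> at most one branching vertex can spare an edge. If some
  \<open>u t1\<close> can, then \<open>card_E\<close> has 3 tripod edges and 2 forced pendant edges
  besides those at \<open>u t1\<close>; otherwise it has 3 and 3 besides those at
  \<open>v\<close>.\<close>

lemma extremal_counts:
  "\<exists>t1 t2 t3. T = {t1, t2, t3} \<and> t1 \<noteq> t2 \<and> t1 \<noteq> t3 \<and> t2 \<noteq> t3 \<and>
     card (pendants (u t2)) = 1 \<and> card (pendants (u t3)) = 1 \<and>
     (card (pendants (u t1)) = 1 \<and> card (pendants v) = card E - 6 \<or>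
      card (pendants (u t1)) = card E - 5 \<and> card (pendants v) = 0)"
proof -
  have fin: "finite (pendants z)" for z using finite_edges unfolding pendants_def by simp
  have one: "card (pendants (u t)) = 1" if t: "t \<in> T" and no: "\<not> (\<exists>f\<in>pendants (u t). \<exists>g\<in>pendants (u t). g \<noteq> f)" for t
  proof -
    obtain f where "f \<in> pendants (u t)" using pendants_u_nonempty[OF t] by blast
    then have "pendants (u t) = {f}" using no by blast
    then show ?thesis by simp
  qed
  obtain s1 s2 s3 where s: "T = {s1, s2, s3}" "s1 \<noteq> s2" "s1 \<noteq> s3" "s2 \<noteq> s3" using T_ex by blast
  show ?thesis
  proof (cases "\<exists>t\<in>T. \<exists>f\<in>pendants (u t). \<exists>g\<in>pendants (u t). g \<noteq> f")
    case True
    then obtain t1 f g where t1: "t1 \<in> T" "f \<in> pendants (u t1)" "g \<in> pendants (u t1)" "g \<noteq> f" by blast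
    have "\<exists>t2 t3. T = {t1, t2, t3} \<and> t1 \<noteq> t2 \<and> t1 \<noteq> t3 \<and> t2 \<noteq> t3"
    proof -
      have "t1 = s1 \<or> t1 = s2 \<or> t1 = s3" using t1(1) s(1) by simp
      then show ?thesis
      proof (elim disjE)
        assume "t1 = s1" then show ?thesis using s by (intro exI[of _ s2] exI[of _ s3]) simp
      next
        assume "t1 = s2"
        moreover have "T = {s2, s1, s3}" using s(1) by blast
        ultimately show ?thesis using s(2-4) by (intro exI[of _ s1] exI[of _ s3]) simp
      next
        assume "t1 = s3"
        moreover have "T = {s3, s1, s2}" using s(1) by blast
        ultimately show ?thesis using s(2-4) by (intro exI[of _ s1] exI[of _ s2]) simp
      qed
    qed
    then obtain t2 t3 where t: "T = {t1, t2, t3}" "t1 \<noteq> t2" "t1 \<noteq> t3" "t2 \<noteq> t3" by blast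
    have other: "card (pendants (u t')) = 1" if "t' \<in> T" "t1 \<noteq> t'" for t'
    proof (rule one[OF that(1)], rule notI)
      assume "\<exists>f\<in>pendants (u t'). \<exists>g\<in>pendants (u t'). g \<noteq> f"
      then obtain f' where f': "f' \<in> pendants (u t')" "\<exists>g\<in>pendants (u t'). g \<noteq> f'" by blast
      have "u t1 = u t'"
        using spare_unique[OF T_ends(4)[OF t1(1)] T_ends(4)[OF that(1)] t1(2) f'(1)] t1(3,4) f'(2) by blast
      then show False using u_inj[OF t1(1) that(1)] that(2) by simp
    qed
    have "pendants v = {}"
    proof (rule ccontr)
      assume "pendants v \<noteq> {}"
      then obtain f' where f': "f' \<in> pendants v" by blast
      have "u t1 = v"
        using spare_unique[OF T_ends(4)[OF t1(1)] deg2_v t1(2) f'] t1(3,4) by blast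
      then show False using T_ends(3)[OF t1(1)] by simp
    qed
    moreover have "card (pendants (u t2)) = 1" "card (pendants (u t3)) = 1"
      using other t by simp_all
    ultimately show ?thesis using t card_E
      by (intro exI[of _ t1] exI[of _ t2] exI[of _ t3]) simp
  next
    case False
    then have "card (pendants (u t)) = 1" if "t \<in> T" for t using one[OF that] that by blast
    then have "card (pendants (u s1)) = 1" "card (pendants (u s2)) = 1" "card (pendants (u s3)) = 1"
      using s(1) by simp_all
    then show ?thesis using s card_E
      by (intro exI[of _ s1] exI[of _ s2] exI[of _ s3]) simp
  qed
qed

end

section \<open>Isomorphism with the extremal power graphs\<close>

lemma hypergraph_iso_sym:
  assumes "G \<cong>\<^sub>h H" "\<And>e. e \<in> edges G \<Longrightarrow> e \<subseteq> verts G"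
  shows "H \<cong>\<^sub>h G"
proof -
  obtain f where f: "bij_betw f (verts G) (verts H)" "edges H = (`) f ` edges G"
    using assms(1) unfolding hypergraph_iso_def by blast
  let ?g = "inv_into (verts G) f"
  have "?g ` f ` e = e" if "e \<in> edges G" for e
    using f(1) assms(2)[OF that] by (simp add: bij_betw_def inv_into_image_cancel)
  then have "(`) ?g ` edges H = edges G" unfolding f(2) image_image by simp
  then show ?thesis
    unfolding hypergraph_iso_def using bij_betw_inv_into[OF f(1)] by metis
qed

lemma uniform_edges_image:
  assumes "uniform_edges k V E" "bij_betw f V W"
  shows "uniform_edges k W ((`) f ` E)"
proof -
  interpret uniform_edges k V E by fact
  show ?thesis
  proof
    show "finite W" using assms(2) finite_verts bij_betw_finite by blast
    fix e assume "e \<in> (`) f ` E"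
    then obtain d where d: "d \<in> E" "e = f ` d" by blast
    show "e \<subseteq> W" using d edge_subset[OF d(1)] assms(2) unfolding bij_betw_def by blast
    show "card e = k"
      using d card_edge edge_subset assms(2) by (metis bij_betw_def card_image inj_on_subset)
  qed (rule k_ge_3)
qed

lemma edge_operator_image:
  assumes "uniform_edges k V E" "inj_on f V" "v \<in> V"
  shows "edge_operator k \<alpha> ((`) f ` E) y (f v) = edge_operator k \<alpha> E (y \<circ> f) v"
proof -
  interpret uniform_edges k V E by fact
  have inj: "inj_on ((`) f) {e \<in> E. v \<in> e}"
    using edge_subset inj_on_image_eq_iff[OF assms(2)] by (intro inj_onI) (metis (lifting) CollectD)
  have mem: "f v \<in> f ` e \<longleftrightarrow> v \<in> e" if "e \<in> E" for e
    using inj_on_image_mem_iff[OF assms(2,3) edge_subset[OF that]] .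
  have "{e \<in> (`) f ` E. f v \<in> e} = (`) f ` {e \<in> E. v \<in> e}" using mem by blast
  moreover have "(\<Prod>w\<in>f ` e - {f v}. y w) = (\<Prod>w\<in>e - {v}. (y \<circ> f) w)" if "e \<in> E" "v \<in> e" for e
  proof -
    have "f ` e - {f v} = f ` (e - {v})"
      using inj_on_image_set_diff[OF assms(2), of e "{v}"] edge_subset[OF that(1)] assms(3) by auto
    moreover have "inj_on f (e - {v})"
      using assms(2) edge_subset[OF that(1)] by (meson Diff_subset inj_on_subset)
    ultimately show ?thesis by (simp add: prod.reindex)
  qed
  ultimately show ?thesis
    unfolding edge_operator_def by (simp add: sum.reindex[OF inj])
qed

lemma eigenvalue_image:
  assumes "uniform_edges k V E" "bij_betw f V W"
    and "tensor_eigenvalue W k (A_tensor k \<alpha> (Hypergraph W ((`) f ` E))) \<mu>"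
  shows "tensor_eigenvalue V k (A_tensor k \<alpha> (Hypergraph V E)) \<mu>"
proof -
  interpret uniform_edges k V E by fact
  interpret W: uniform_edges k W "(`) f ` E" by (rule uniform_edges_image[OF assms(1,2)])
  have fV: "f ` V = W" "inj_on f V" using assms(2) unfolding bij_betw_def by auto
  obtain y where y: "\<exists>w\<in>W. y w \<noteq> 0"
    "\<And>w. w \<in> W \<Longrightarrow> edge_operator k \<alpha> ((`) f ` E) y w = \<mu> * y w ^ (k - 1)"
    using assms(3) unfolding tensor_eigenvalue_def by (auto simp: W.tensor_apply_eq)
  have "edge_operator k \<alpha> E (y \<circ> f) v = \<mu> * (y \<circ> f) v ^ (k - 1)" if "v \<in> V" for v
    using y(2)[of "f v"] edge_operator_image[OF assms(1) fV(2) that, of \<alpha> y] fV(1) that by auto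
  moreover have "\<exists>v\<in>V. (y \<circ> f) v \<noteq> 0" using y(1) fV(1) by auto
  ultimately show ?thesis
    unfolding tensor_eigenvalue_def by (intro exI[of _ "y \<circ> f"]) (simp add: tensor_apply_eq)
qed

lemma eigenvalue_iso:
  assumes "uniform_edges k (verts G) (edges G)" "G \<cong>\<^sub>h H"
    and "tensor_eigenvalue (verts H) k (A_tensor k \<alpha> H) \<mu>"
  shows "tensor_eigenvalue (verts G) k (A_tensor k \<alpha> G) \<mu>"
proof -
  obtain f where f: "bij_betw f (verts G) (verts H)" "edges H = (`) f ` edges G"
    using assms(2) unfolding hypergraph_iso_def by blast
  have "Hypergraph (verts H) ((`) f ` edges G) = H" using f(2) by (cases H) simp
  then show ?thesis using eigenvalue_image[OF assms(1) f(1), of \<alpha> \<mu>] assms(3) by simp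
qed

lemma rho_iso:
  assumes "uniform_edges k (verts G) (edges G)" "G \<cong>\<^sub>h H"
  shows "rho k \<alpha> G = rho k \<alpha> H"
proof -
  obtain f where f: "bij_betw f (verts G) (verts H)" "edges H = (`) f ` edges G"
    using assms(2) unfolding hypergraph_iso_def by blast
  have uH: "uniform_edges k (verts H) (edges H)"
    unfolding f(2) by (rule uniform_edges_image[OF assms(1) f(1)])
  have "H \<cong>\<^sub>h G"
    using hypergraph_iso_sym[OF assms(2)] uniform_edges.edge_subset[OF assms(1)] by blast
  then have "{\<mu>. tensor_eigenvalue (verts G) k (A_tensor k \<alpha> G) \<mu>} =
      {\<mu>. tensor_eigenvalue (verts H) k (A_tensor k \<alpha> H) \<mu>}"
    using eigenvalue_iso[OF assms] eigenvalue_iso[OF uH] by blast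
  then show ?thesis unfolding rho_def by simp
qed

text \<open>The tree \<open>P\<close> is rooted at \<open>r\<close>, so that its edges are indexed by the non-root vertices \<open>c\<close>; \<open>g\<close> and \<open>h\<close>
  embed its vertices and edges, and the remaining \<open>k - 2\<close> vertices of \<open>h c\<close> are private to it.\<close>

lemma iso_power_graph:
  fixes g :: "'b \<Rightarrow> 'a" and h :: "'b \<Rightarrow> 'a set"
  assumes E: "uniform_edges k V E" and V: "\<Union>E = V"
    and verts: "verts P = insert r C" and edges: "edges P = (\<lambda>c. {c, par c}) ` C"
    and inj_edge: "inj_on (\<lambda>c. {c, par c}) C"
    and par: "\<And>c. c \<in> C \<Longrightarrow> par c \<in> insert r C \<and> par c \<noteq> c"
    and g: "inj_on g (insert r C)" "g ` insert r C \<subseteq> V"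
    and h: "inj_on h C" "h ` C = E"
    and meet: "\<And>c. c \<in> C \<Longrightarrow> h c \<inter> g ` insert r C = {g c, g (par c)}"
    and disj: "\<And>c d z. c \<in> C \<Longrightarrow> d \<in> C \<Longrightarrow> c \<noteq> d \<Longrightarrow> z \<in> h c \<Longrightarrow> z \<in> h d \<Longrightarrow> z \<in> g ` insert r C"
  shows "Hypergraph V E \<cong>\<^sub>h power_graph k P"
proof -
  interpret uniform_edges k V E by fact
  let ?R = "insert r C" and ?d = "\<lambda>c. {c, par c}"
  have hE: "h c \<in> E" if "c \<in> C" for c using h(2) that by blast
  have "\<exists>b. bij_betw b {..<k - 2} (h c - g ` ?R)" if c: "c \<in> C" for c
  proof -
    have "g c \<noteq> g (par c)" using inj_onD[OF g(1), of c "par c"] par[OF c] c by auto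
    then have "card (h c \<inter> g ` ?R) = 2" unfolding meet[OF c] by simp
    moreover have "card (h c - g ` ?R) = card (h c) - card (h c \<inter> g ` ?R)"
      using finite_edge[OF hE[OF c]] by (simp add: card_Diff_subset_Int)
    ultimately have "card (h c - g ` ?R) = k - 2" using card_edge[OF hE[OF c]] by simp
    moreover have "finite (h c - g ` ?R)" using finite_edge[OF hE[OF c]] by simp
    ultimately show ?thesis using ex_bij_betw_nat_finite by (metis atLeast0LessThan)
  qed
  \<comment> \<open>Numbers the \<open>k - 2\<close> private vertices of each edge
    \<open>h c\<close>, to be matched with the new vertices of the power.\<close>
  then obtain b where b: "\<And>c. c \<in> C \<Longrightarrow> bij_betw (b c) {..<k - 2} (h c - g ` ?R)" by metis
  have b_img: "b c ` {..<k - 2} = h c - g ` ?R" if "c \<in> C" for c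
    using b[OF that] unfolding bij_betw_def by blast
  have bi: "b c i \<in> h c" "b c i \<notin> g ` ?R" if "c \<in> C" "i < k - 2" for c i
    using b_img[OF that(1)] that(2) by blast+
  \<comment> \<open>The map runs from the power graph to \<open>V\<close>. A new vertex carries its
    tree edge as a set, so \<open>inv_into\<close> recovers the child \<open>c\<close> that indexes
    it.\<close>
  define \<phi> where "\<phi> = case_sum g (\<lambda>p. b (inv_into C ?d (fst p)) (snd p))"
  have \<phi>_Inl: "\<phi> (Inl z) = g z" for z by (simp add: \<phi>_def)
  have \<phi>_Inr: "\<phi> (Inr ({c, par c}, i)) = b c i" if "c \<in> C" for c i
    using inv_into_f_f[OF inj_edge that] by (simp add: \<phi>_def)
  let ?G = "power_graph k P"
  have vG: "verts ?G = Inl ` ?R \<union> {Inr ({c, par c}, i) |c i. c \<in> C \<and> i < k - 2}"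
    unfolding power_graph_def using verts edges by auto
  define ext where "ext c = Inl ` {c, par c} \<union> {Inr ({c, par c}, i) |i. i < k - 2}" for c
  have eG: "edges ?G = ext ` C"
    unfolding power_graph_def ext_def edges hypergraph.sel
    by (simp only: Setcompr_eq_image image_image)
  have \<phi>_ext: "\<phi> ` ext c = h c" if c: "c \<in> C" for c
  proof -
    have "\<phi> ` ext c = {g c, g (par c)} \<union> b c ` {..<k - 2}"
    proof -
      have "{Inr ({c, par c}, i) |i. i < k - 2} = (\<lambda>i. Inr ({c, par c}, i) :: 'b + 'b set \<times> nat) ` {..<k - 2}"
        by blast
      then have "\<phi> ` {Inr ({c, par c}, i) |i. i < k - 2} = b c ` {..<k - 2}"
        by (simp only: image_image \<phi>_Inr[OF c])
      then show ?thesis unfolding ext_def image_Un by (simp add: \<phi>_Inl)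
    qed
    also have "\<dots> = h c" unfolding b_img[OF c] meet[OF c, symmetric] by blast
    finally show ?thesis .
  qed
  have inj: "inj_on \<phi> (verts ?G)"
  proof (rule inj_onI)
    have Inr: "\<exists>c i. p = Inr ({c, par c}, i) \<and> c \<in> C \<and> i < k - 2" if "p \<in> verts ?G" "p \<notin> Inl ` ?R" for p
      using that unfolding vG by blast
    fix p q assume p: "p \<in> verts ?G" and q: "q \<in> verts ?G" and eq: "\<phi> p = \<phi> q"
    have cross: False if pq: "p \<in> Inl ` ?R" "q \<in> verts ?G" "q \<notin> Inl ` ?R" "\<phi> p = \<phi> q" for p q
    proof -
      obtain c i where "q = Inr ({c, par c}, i)" "c \<in> C" "i < k - 2" using Inr pq(2,3) by blast
      then have "\<phi> q \<notin> g ` ?R" using \<phi>_Inr bi(2) by simp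
      moreover have "\<phi> p \<in> g ` ?R" using pq(1) \<phi>_Inl by auto
      ultimately show False using pq(4) by simp
    qed
    show "p = q"
    proof (cases "p \<in> Inl ` ?R")
      case True
      then have "q \<in> Inl ` ?R" using cross q eq by blast
      then obtain x y where xy: "p = Inl x" "q = Inl y" "x \<in> ?R" "y \<in> ?R" using True by blast
      then show ?thesis using eq inj_onD[OF g(1) _ xy(3,4)] by (simp add: \<phi>_Inl)
    next
      case False
      then have qn: "q \<notin> Inl ` ?R" using cross[OF _ p _ eq[symmetric]] by blast
      obtain c i where c: "p = Inr ({c, par c}, i)" "c \<in> C" "i < k - 2" using Inr p False by blast
      obtain d j where d: "q = Inr ({d, par d}, j)" "d \<in> C" "j < k - 2" using Inr q qn by blast
      have bb: "b c i = b d j" using eq c d \<phi>_Inr by simp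
      have "c = d"
      proof (rule ccontr)
        assume "c \<noteq> d"
        then have "b c i \<in> g ` ?R" using disj[OF c(2) d(2)] bi(1)[OF c(2,3)] bi(1)[OF d(2,3)] bb by simp
        then show False using bi(2)[OF c(2,3)] by simp
      qed
      moreover from this have "i = j"
        using b[OF c(2)] bb c(3) d(3) unfolding bij_betw_def by (metis inj_onD lessThan_iff)
      ultimately show ?thesis using c(1) d(1) by simp
    qed
  qed
  have surj: "\<phi> ` verts ?G = V"
  proof
    show "\<phi> ` verts ?G \<subseteq> V"
    proof
      fix z assume "z \<in> \<phi> ` verts ?G"
      then obtain p where p: "p \<in> verts ?G" "z = \<phi> p" by blast
      show "z \<in> V"
      proof (cases "p \<in> Inl ` ?R")
        case True
        then show ?thesis using p(2) g(2) \<phi>_Inl by auto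
      next
        case False
        then obtain c i where c: "p = Inr ({c, par c}, i)" "c \<in> C" "i < k - 2"
          using p(1) unfolding vG by blast
        then have "z = b c i" using p(2) \<phi>_Inr by simp
        then show ?thesis using bi(1)[OF c(2,3)] edge_subset[OF hE[OF c(2)]] by blast
      qed
    qed
    have "h c \<subseteq> \<phi> ` verts ?G" if c: "c \<in> C" for c
    proof -
      have "ext c \<subseteq> verts ?G" unfolding ext_def vG using c par[OF c] by blast
      then show ?thesis using \<phi>_ext[OF c] by (metis image_mono)
    qed
    then show "V \<subseteq> \<phi> ` verts ?G" using h(2) unfolding V[symmetric] by blast
  qed
  have "(`) \<phi> ` edges ?G = E"
    unfolding eG image_image using \<phi>_ext h(2) by simp
  then have "?G \<cong>\<^sub>h Hypergraph V E"
    unfolding hypergraph_iso_def using inj surj by (intro exI[of _ \<phi>]) (simp add: bij_betw_def)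
  then show ?thesis
  proof (rule hypergraph_iso_sym)
    fix e assume "e \<in> edges ?G"
    then obtain c where "c \<in> C" "e = ext c" unfolding eG by blast
    then show "e \<subseteq> verts ?G" unfolding ext_def vG using par by blast
  qed
qed

text \<open>The non-root vertices when the tree is rooted at \<open>CenterV\<close>. The first three
  are the outer branching vertices of the tripod, the rest are leaves, including the far ends of the
  two paths.\<close>

definition T_children :: "nat \<Rightarrow> nat \<Rightarrow> tvertex set" where
  "T_children s t = {CenterU, PathA 0, PathB 0} \<union>
     ({PathA (Suc 0), PathB (Suc 0)} \<union> LeafU ` {..<s} \<union> LeafV ` {..<t})"

fun T_parent :: "tvertex \<Rightarrow> tvertex" where
  "T_parent (LeafU i) = CenterU"
| "T_parent (PathA (Suc i)) = PathA i"
| "T_parent (PathB (Suc i)) = PathB i"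
| "T_parent _ = CenterV"

lemma T_graph_children:
  "verts (T_graph s t 2 2) = insert CenterV (T_children s t)"
  "edges (T_graph s t 2 2) = (\<lambda>c. {c, T_parent c}) ` T_children s t"
  "inj_on (\<lambda>c. {c, T_parent c}) (T_children s t)"
  "c \<in> T_children s t \<Longrightarrow> T_parent c \<in> insert CenterV (T_children s t) \<and> T_parent c \<noteq> c"
proof -
  have two: "{..2::nat} = {0, Suc 0, Suc (Suc 0)}" by auto
  show "verts (T_graph s t 2 2) = insert CenterV (T_children s t)"
    unfolding T_graph_def double_star_def T_children_def two by auto
  have path: "{f i |i. i < (2::nat)} = {f 0, f (Suc 0)}" for f :: "nat \<Rightarrow> tvertex set"
    by (auto simp: less_2_cases_iff)
  have ds: "edges (double_star s t) = {{CenterU, CenterV}} \<union>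
      (\<lambda>c. {c, CenterU}) ` LeafU ` {..<s} \<union> (\<lambda>c. {c, CenterV}) ` LeafV ` {..<t}"
    unfolding double_star_def by (auto simp: insert_commute)
  show "edges (T_graph s t 2 2) = (\<lambda>c. {c, T_parent c}) ` T_children s t"
    unfolding T_graph_def T_children_def hypergraph.sel ds path
    by (auto simp: insert_commute image_image image_Un)
  show "inj_on (\<lambda>c. {c, T_parent c}) (T_children s t)"
    unfolding T_children_def inj_on_def by (auto simp: doubleton_eq_iff)
  show "c \<in> T_children s t \<Longrightarrow> T_parent c \<in> insert CenterV (T_children s t) \<and> T_parent c \<noteq> c"
    unfolding T_children_def by auto
qed

section \<open>Matching a tripod with the power of its tree\<close>

context tripod
begin

text \<open>A degree-one vertex of a pendant edge, chosen to stand for the leaf of the underlying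
  tree edge; the other degree-one vertices become the new vertices of the power.\<close>

definition leaf :: "'a set \<Rightarrow> 'a" where
  "leaf f = (SOME z. z \<in> f \<and> \<not> deg2 E z)"

lemma leaf:
  assumes f: "f \<in> E - T"
  shows "leaf f \<in> f" "\<not> deg2 E (leaf f)"
proof -
  have "\<exists>z. z \<in> f \<and> \<not> deg2 E z"
  proof (rule ccontr)
    assume "\<not> ?thesis"
    then have "\<forall>a\<in>f. \<forall>b\<in>f. a = b" using pendant_deg2_unique[OF f] by blast
    then have "card f \<le> 1" using finite_edge f card_le_Suc0_iff_eq[of f] by simp
    then show False using card_edge[of f] f k_ge_3 by simp
  qed
  then have "leaf f \<in> f \<and> \<not> deg2 E (leaf f)" unfolding leaf_def by (rule someI_ex)
  then show "leaf f \<in> f" "\<not> deg2 E (leaf f)" by blast+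
qed

text \<open>The edge \<open>t1\<close> becomes the central edge, \<open>t2\<close> and
  \<open>t3\<close> the first edges of the two paths, and the single pendant edges at
  \<open>u t2\<close> and \<open>u t3\<close> their second edges. Pendant edges at
  \<open>u t1\<close> and \<open>v\<close> become the leaves at the two centres.\<close>

lemma iso_T_graph:
  assumes t: "T = {t1, t2, t3}" "t1 \<noteq> t2" "t1 \<noteq> t3" "t2 \<noteq> t3"
    and c2: "card (pendants (u t2)) = 1" and c3: "card (pendants (u t3)) = 1"
  shows "Hypergraph V E \<cong>\<^sub>h power_graph k (T_graph (card (pendants (u t1))) (card (pendants v)) 2 2)"
proof -
  let ?s = "card (pendants (u t1))" and ?t = "card (pendants v)"
  let ?C = "T_children ?s ?t"
  let ?L = "{PathA (Suc 0), PathB (Suc 0)} \<union> LeafU ` {..<?s} \<union> LeafV ` {..<?t}"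
  have fin: "finite (pendants z)" for z using finite_edges unfolding pendants_def by simp
  have tT: "t1 \<in> T" "t2 \<in> T" "t3 \<in> T" using t(1) by simp_all
  obtain p1 where p1: "p1 ` {..<?s} = pendants (u t1)"
    using ex_bij_betw_nat_finite[OF fin] unfolding bij_betw_def atLeast0LessThan by blast
  obtain p0 where p0: "p0 ` {..<?t} = pendants v"
    using ex_bij_betw_nat_finite[OF fin] unfolding bij_betw_def atLeast0LessThan by blast
  obtain f2 where f2: "pendants (u t2) = {f2}" using c2 card_1_singletonE by blast
  obtain f3 where f3: "pendants (u t3) = {f3}" using c3 card_1_singletonE by blast
  define h where "h c = (case c of CenterU \<Rightarrow> t1 | CenterV \<Rightarrow> {} | LeafU i \<Rightarrow> p1 i | LeafV i \<Rightarrow> p0 i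
      | PathA i \<Rightarrow> (if i = 0 then t2 else f2) | PathB i \<Rightarrow> (if i = 0 then t3 else f3))" for c
  define g where "g c = (if c = CenterV then v else if c = CenterU then u t1
      else if c = PathA 0 then u t2 else if c = PathB 0 then u t3 else leaf (h c))" for c
  have h_simps: "h CenterU = t1" "h (LeafU i) = p1 i" "h (LeafV i) = p0 i" "h (PathA 0) = t2"
    "h (PathA (Suc 0)) = f2" "h (PathB 0) = t3" "h (PathB (Suc 0)) = f3" for i
    by (simp_all add: h_def)
  have g_simps: "g CenterV = v" "g CenterU = u t1" "g (PathA 0) = u t2" "g (PathB 0) = u t3"
    by (simp_all add: g_def)
  have Leaf: "h c \<in> E - T \<and> g c = leaf (h c) \<and> g (T_parent c) \<in> h c \<and> deg2 E (g (T_parent c))"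
    if "c \<in> ?L" for c
  proof -
    have gl: "g c = leaf (h c)" using that by (auto simp: g_def)
    have "h c \<in> pendants (g (T_parent c)) \<and> deg2 E (g (T_parent c))"
      using that
    proof (elim UnE)
      assume "c \<in> {PathA (Suc 0), PathB (Suc 0)}"
      then show ?thesis using f2 f3 T_ends(4) tT by (auto simp: h_simps g_simps)
    next
      assume "c \<in> LeafU ` {..<?s}"
      then show ?thesis using p1 T_ends(4)[OF tT(1)] by (auto simp: h_simps g_simps)
    next
      assume "c \<in> LeafV ` {..<?t}"
      then show ?thesis using p0 deg2_v by (auto simp: h_simps g_simps)
    qed
    then show ?thesis using gl unfolding pendants_def by blast
  qed
  have Core: "h c \<in> T \<and> g c = u (h c) \<and> g (T_parent c) = v" if "c \<in> {CenterU, PathA 0, PathB 0}" for c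
    using that tT by (auto simp: h_simps g_simps)
  have C: "c \<in> {CenterU, PathA 0, PathB 0} \<or> c \<in> ?L" if "c \<in> ?C" for c
    using that unfolding T_children_def by blast
  have hE: "h ` ?C = E"
  proof
    show "h ` ?C \<subseteq> E"
    proof
      fix f assume "f \<in> h ` ?C"
      then obtain c where c: "c \<in> ?C" "f = h c" by blast
      from C[OF c(1)] show "f \<in> E"
      proof
        assume "c \<in> {CenterU, PathA 0, PathB 0}"
        from Core[OF this] show ?thesis using c(2) T_sub by blast
      next
        assume "c \<in> ?L"
        from Leaf[OF this] show ?thesis using c(2) by blast
      qed
    qed
    show "E \<subseteq> h ` ?C"
    proof
      fix f assume f: "f \<in> E"
      show "f \<in> h ` ?C"
      proof (cases "f \<in> T")
        case True
        then have "f = h CenterU \<or> f = h (PathA 0) \<or> f = h (PathB 0)" using t(1) by (simp add: h_simps)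
        then show ?thesis unfolding T_children_def by blast
      next
        case False
        then obtain z where z: "z \<in> f" "deg2 E z" using pendant_has_deg2 f by blast
        then have "f \<in> pendants z" using f False unfolding pendants_def by blast
        moreover have "z = v \<or> z = u t1 \<or> z = u t2 \<or> z = u t3" using deg2_cases[OF z(2)] t(1) by simp
        ultimately have "f \<in> p0 ` {..<?t} \<or> f \<in> p1 ` {..<?s} \<or> f = f2 \<or> f = f3"
          unfolding p0 p1 using f2 f3 by blast
        then have "f \<in> h ` LeafV ` {..<?t} \<or> f \<in> h ` LeafU ` {..<?s} \<or> f = h (PathA (Suc 0)) \<or>
            f = h (PathB (Suc 0))"
          by (simp add: image_image h_simps)
        then show ?thesis unfolding T_children_def by blast
      qed
    qed
  qed
  have finC: "finite ?C" unfolding T_children_def by simp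
  \<comment> \<open>Injectivity of \<open>h\<close> by counting: it maps \<open>?C\<close> onto
    \<open>E\<close>, and \<open>?C\<close> is no larger than \<open>E\<close>.\<close>
  have "card ?C \<le> card E"
  proof -
    have "card ?C \<le> card {CenterU, PathA 0, PathB 0} + card ?L"
      unfolding T_children_def by (rule card_Un_le)
    moreover have "card ?L \<le> card {PathA (Suc 0), PathB (Suc 0)} + card (LeafU ` {..<?s}) + card (LeafV ` {..<?t})"
      using card_Un_le[of "{PathA (Suc 0), PathB (Suc 0)} \<union> LeafU ` {..<?s}" "LeafV ` {..<?t}"]
        card_Un_le[of "{PathA (Suc 0), PathB (Suc 0)}" "LeafU ` {..<?s}"] by linarith
    moreover have "card (LeafU ` {..<?s}) \<le> ?s" "card (LeafV ` {..<?t}) \<le> ?t"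
      using card_image_le[of "{..<?s}" LeafU] card_image_le[of "{..<?t}" LeafV] by simp_all
    moreover have "card E = 3 + ?t + (?s + (1 + 1))"
      using card_E t c2 c3 by simp
    ultimately show ?thesis by simp
  qed
  then have inj_h: "inj_on h ?C"
    using finC hE card_image_le[OF finC, of h] by (intro eq_card_imp_inj_on) simp_all
  have core_deg2: "z \<in> g ` insert CenterV ?C" if "deg2 E z" for z
  proof -
    have "z = g CenterV \<or> z = g CenterU \<or> z = g (PathA 0) \<or> z = g (PathB 0)"
      using deg2_cases[OF that] t(1) by (simp add: g_simps)
    then show ?thesis unfolding T_children_def by blast
  qed
  have ends: "g c \<in> h c" "g (T_parent c) \<in> h c" if "c \<in> ?C" for c
    using C[OF that] Core[of c] Leaf[of c] T_ends(1,2) leaf(1) by metis+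
  \<comment> \<open>A vertex of degree one determines its edge, and the injectivity of
    \<open>h\<close> then determines the tree vertex. This separates both the images of leaves and
    the private vertices.\<close>
  have edge_eq: "c = d" if "c \<in> ?C" "d \<in> ?C" "z \<in> h c" "z \<in> h d" "\<not> deg2 E z" for c d z
  proof -
    have "h c \<in> E" "h d \<in> E" using hE that by blast+
    then have "h c = h d" using that(3-5) deg2I by metis
    then show ?thesis using inj_onD[OF inj_h] that by blast
  qed
  have leaf_g: "\<not> deg2 E (g c)" if "c \<in> ?L" for c using Leaf[OF that] leaf(2) by metis
  have LC: "?L \<subseteq> ?C" unfolding T_children_def by blast
  have deg2_g: "deg2 E (g c)" if "c \<in> {CenterV, CenterU, PathA 0, PathB 0}" for c
    using that deg2_v T_ends(4) tT by (auto simp: g_simps)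
  have R: "c \<in> {CenterV, CenterU, PathA 0, PathB 0} \<or> c \<in> ?L" if "c \<in> insert CenterV ?C" for c
    using that C by blast
  have inj_g: "inj_on g (insert CenterV ?C)"
  proof (rule inj_onI)
    fix c d assume c: "c \<in> insert CenterV ?C" and d: "d \<in> insert CenterV ?C" and eq: "g c = g d"
    show "c = d"
    proof (cases "deg2 E (g c)")
      case True
      then have "c \<in> {CenterV, CenterU, PathA 0, PathB 0}" "d \<in> {CenterV, CenterU, PathA 0, PathB 0}"
        using R[OF c] R[OF d] leaf_g eq by metis+
      moreover have "u t1 \<noteq> u t2" "u t1 \<noteq> u t3" "u t2 \<noteq> u t3" using u_inj tT t by blast+
      ultimately show ?thesis using eq T_ends(3)[OF tT(1)] T_ends(3)[OF tT(2)] T_ends(3)[OF tT(3)]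
        by (auto simp: g_simps)
    next
      case False
      then have "c \<in> ?L" "d \<in> ?L" using R[OF c] R[OF d] deg2_g eq by metis+
      then have "c \<in> ?C" "d \<in> ?C" using LC by blast+
      then show ?thesis using edge_eq[of c d "g c"] ends(1)[of c] ends(1)[of d] eq False by simp
    qed
  qed
  have gV: "g ` insert CenterV ?C \<subseteq> V"
  proof -
    have "g c \<in> V" if "c \<in> ?C" for c
    proof -
      have "h c \<in> E" using hE that by blast
      then show ?thesis using ends(1)[OF that] edge_subset by blast
    qed
    moreover have "g CenterV \<in> V"
      using T_ends(1)[OF tT(1)] edge_subset[OF subsetD[OF T_sub tT(1)]] unfolding g_simps by blast
    ultimately show ?thesis by blast
  qed
  have meet: "h c \<inter> g ` insert CenterV ?C = {g c, g (T_parent c)}" if c: "c \<in> ?C" for c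
  proof
    show "{g c, g (T_parent c)} \<subseteq> h c \<inter> g ` insert CenterV ?C"
      using ends[OF c] c T_graph_children(4)[OF c] by blast
    show "h c \<inter> g ` insert CenterV ?C \<subseteq> {g c, g (T_parent c)}"
    proof
      fix z assume "z \<in> h c \<inter> g ` insert CenterV ?C"
      then obtain d where d: "d \<in> insert CenterV ?C" "z = g d" "z \<in> h c" by blast
      show "z \<in> {g c, g (T_parent c)}"
      proof (cases "deg2 E z")
        case True
        from C[OF c] show ?thesis
        proof
          assume "c \<in> {CenterU, PathA 0, PathB 0}"
          from Core[OF this] have "h c \<in> T" "g c = u (h c)" "g (T_parent c) = v" by blast+
          then show ?thesis using T_deg2[of "h c" z] d(3) True by auto
        next
          assume "c \<in> ?L"
          from Leaf[OF this] have "z = g (T_parent c)"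
            using pendant_deg2_unique[of "h c" z "g (T_parent c)"] d(3) True by blast
          then show ?thesis by simp
        qed
      next
        case False
        then have "d \<in> ?L" using R[OF d(1)] deg2_g[of d] d(2) by metis
        then have dC: "d \<in> ?C" using LC by blast
        then have "c = d" using edge_eq[OF c dC d(3) _ False] ends(1)[OF dC] d(2) by simp
        then show ?thesis using d(2) by simp
      qed
    qed
  qed
  show ?thesis
  proof (rule iso_power_graph[OF uniform_edges_axioms _ T_graph_children inj_g gV inj_h hE meet])
    show "\<Union>E = V" using Union_edges T_sub tT(1) by blast
    fix c d z assume "c \<in> ?C" "d \<in> ?C" "c \<noteq> d" "z \<in> h c" "z \<in> h d"
    then show "z \<in> g ` insert CenterV ?C" using edge_eq core_deg2 by blast
  qed simp_all
qed

end

lemma (in extremal) iso_H1_or_H2: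
  assumes "branch_vertex E"
  shows "Hypergraph V E \<cong>\<^sub>h H1 k (card E) \<or> Hypergraph V E \<cong>\<^sub>h H2 k (card E)"
proof -
  obtain v u where vu: "card {f \<in> E. nonpendant E f} = 3"
    "\<forall>t\<in>{f \<in> E. nonpendant E f}. v \<in> t \<and> u t \<in> t \<and> u t \<noteq> v \<and> deg2 E (u t) \<and>
      (\<forall>z\<in>t. deg2 E z \<longrightarrow> z = v \<or> z = u t)"
    using tripod_structure[OF assms] by blast
  interpret extremal_tripod k V E \<alpha> "{f \<in> E. nonpendant E f}" v u
    by unfold_locales (use vu in blast)+
  obtain t1 t2 t3 where t: "{f \<in> E. nonpendant E f} = {t1, t2, t3}" "t1 \<noteq> t2" "t1 \<noteq> t3" "t2 \<noteq> t3"
    and c: "card (pendants (u t2)) = 1" "card (pendants (u t3)) = 1"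
    and cases: "card (pendants (u t1)) = 1 \<and> card (pendants v) = card E - 6 \<or>
      card (pendants (u t1)) = card E - 5 \<and> card (pendants v) = 0"
    using extremal_counts by blast
  from cases iso_T_graph[OF t c] show ?thesis
    unfolding H1_def H2_def by auto
qed

theorem theorem5p3:
  fixes G :: "'a hypergraph" and k m :: nat and \<alpha> :: real
  assumes "k \<ge> 3" and "0 \<le> \<alpha>" and "\<alpha> < 1" and "m \<ge> 6"
    and "G \<in> NC k m"
  shows "rho k \<alpha> G \<le> max (rho k \<alpha> (H1 k m)) (rho k \<alpha> (H2 k m)) \<and>
    (rho k \<alpha> G = max (rho k \<alpha> (H1 k m)) (rho k \<alpha> (H2 k m)) \<longleftrightarrow>
      (G \<cong>\<^sub>h H1 k m \<and> rho k \<alpha> (H1 k m) = max (rho k \<alpha> (H1 k m)) (rho k \<alpha> (H2 k m))) \<or>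
      (G \<cong>\<^sub>h H2 k m \<and> rho k \<alpha> (H2 k m) = max (rho k \<alpha> (H1 k m)) (rho k \<alpha> (H2 k m))))"
proof -
  let ?V = "verts G" and ?r = "\<lambda>E. rho k \<alpha> (Hypergraph (verts G) E)"
  let ?max = "max (rho k \<alpha> (H1 k m)) (rho k \<alpha> (H2 k m))"
  define \<C> where "\<C> = {E. hypertree k ?V E \<and> card E = m \<and> (branch_vertex E \<or> branch_edge E)}"
  have G: "edges G \<in> \<C>"
    using branch_of_NC[OF assms(5,1)] assms(4,5) unfolding \<C>_def NC_def by simp
  then have hG: "hypertree k ?V (edges G)" unfolding \<C>_def by blast
  then have uG: "uniform_edges k ?V (edges G)" by (rule hypertree.axioms(1))
  have rG: "?r (edges G) = rho k \<alpha> G" by simp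
  have "finite ?V" using uG by (rule uniform_edges.finite_verts)
  moreover have "\<C> \<subseteq> Pow (Pow ?V)"
    unfolding \<C>_def using uniform_edges.edge_subset hypertree.axioms(1) by blast
  ultimately have fin: "finite \<C>" by (meson finite_Pow_iff finite_subset)
  have iso: "Hypergraph ?V E \<cong>\<^sub>h H1 k m \<or> Hypergraph ?V E \<cong>\<^sub>h H2 k m"
    if E: "E \<in> \<C>" and max: "\<And>E'. E' \<in> \<C> \<Longrightarrow> ?r E' \<le> ?r E" for E
  proof -
    interpret hypertree k ?V E using E unfolding \<C>_def by blast
    have m: "card E = m" using E unfolding \<C>_def by blast
    interpret extremal k ?V E \<alpha>
      by unfold_locales (use assms(2,3) max m in \<open>auto simp: \<C>_def\<close>)
    have "branch_vertex E" using not_branch_edge E unfolding \<C>_def by blast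
    then show ?thesis using iso_H1_or_H2 unfolding m by blast
  qed
  have iso_rho: "?r E = rho k \<alpha> H" if "E \<in> \<C>" "Hypergraph ?V E \<cong>\<^sub>h H" for E and H :: "(tvertex + tvertex set \<times> nat) hypergraph"
  proof (rule rho_iso[OF _ that(2)])
    show "uniform_edges k (verts (Hypergraph ?V E)) (edges (Hypergraph ?V E))"
      using that(1) hypertree.axioms(1) unfolding \<C>_def by auto
  qed
  obtain E where E: "E \<in> \<C>" "\<And>E'. E' \<in> \<C> \<Longrightarrow> ?r E' \<le> ?r E"
  proof -
    have "Max (?r ` \<C>) \<in> ?r ` \<C>" using fin G by (intro Max_in) auto
    then obtain E where "Max (?r ` \<C>) = ?r E" "E \<in> \<C>" by (rule imageE)
    moreover have "?r E' \<le> Max (?r ` \<C>)" if "E' \<in> \<C>" for E' using fin that by (intro Max_ge) auto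
    ultimately show ?thesis using that[of E] by simp
  qed
  have "?r E \<le> ?max" using iso[OF E] iso_rho[OF E(1)] by auto
  then have le: "?r E' \<le> ?max" if "E' \<in> \<C>" for E' using E(2)[OF that] by linarith
  have "rho k \<alpha> G \<le> ?max" using le[OF G] rG by simp
  moreover have "G \<cong>\<^sub>h H1 k m \<and> rho k \<alpha> (H1 k m) = ?max \<or> G \<cong>\<^sub>h H2 k m \<and> rho k \<alpha> (H2 k m) = ?max"
    if eq: "rho k \<alpha> G = ?max"
  proof -
    \<comment> \<open>Equality makes \<open>G\<close> itself a maximiser of the class, so the
      classification of maximisers applies to it directly.\<close>
    have "?r E' \<le> ?r (edges G)" if "E' \<in> \<C>" for E' using le[OF that] eq rG by simp
    then have "G \<cong>\<^sub>h H1 k m \<or> G \<cong>\<^sub>h H2 k m" using iso[OF G] by simp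
    then show ?thesis using rho_iso[OF uG] eq by metis
  qed
  moreover have "rho k \<alpha> G = ?max"
    if "G \<cong>\<^sub>h H1 k m \<and> rho k \<alpha> (H1 k m) = ?max \<or> G \<cong>\<^sub>h H2 k m \<and> rho k \<alpha> (H2 k m) = ?max"
    using that rho_iso[OF uG] by metis
  ultimately show ?thesis by blast
qed

end
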